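(* Let $p \in (1, \infty)$, and let $A$ be a unital $L^p$-operator algebra. Let $\varphi$ be a state on $A$ and let $e \in A$ be a real positive idempotent. If $\varphi(e) = 0$ then $\varphi(ae) = \varphi(ea) = 0$ for all $a \in A$.
   Context: An $L^p$-operator algebra is a (complex) Banach algebra isometrically isomorphic to a norm closed subalgebra of $B(L^p(X,\mu))$ for some measure space $(X,\mu)$. A unital Banach algebra is one with an identity $1$ of norm $1$. A state on a unital Banach algebra $A$ is a linear functional $\omega$ with $\|\omega\|=\omega(1)=1$. An element $a$ of a unital Banach algebra is real positive if $\mathrm{Re}\,\omega(a)\ge0$ for all states $\omega$ (for an idempotent $e$ this is equivalent to $\|1-e\|\le 1$). *)

theory Defs
  imports "HOL-Analysis.Analysis"
begin

section \<open>Complex unital Banach algebras\<close>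

text \<open>
  The library classes \<^class>\<open>real_normed_algebra_1\<close> and \<^class>\<open>banach\<close> provide a complete,
  submultiplicative norm with \<^prop>\<open>norm 1 = 1\<close>, but only real scalars. The class below adds a
  complex scalar multiplication that extends the real one.
\<close>

class complex_banach_algebra_1 = real_normed_algebra_1 + banach +
  fixes scaleC :: "complex \<Rightarrow> 'a \<Rightarrow> 'a"  (infixr \<open>*\<^sub>C\<close> 75)
  assumes scaleC_add_right: "c *\<^sub>C (x + y) = c *\<^sub>C x + c *\<^sub>C y"
    and scaleC_add_left: "(c + d) *\<^sub>C x = c *\<^sub>C x + d *\<^sub>C x"
    and scaleC_scaleC: "c *\<^sub>C d *\<^sub>C x = (c * d) *\<^sub>C x"
    and scaleR_scaleC: "r *\<^sub>R x = complex_of_real r *\<^sub>C x"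
    and mult_scaleC_left: "(c *\<^sub>C x) * y = c *\<^sub>C (x * y)"
    and mult_scaleC_right: "x * (c *\<^sub>C y) = c *\<^sub>C (x * y)"
    and norm_scaleC: "norm (c *\<^sub>C x) = cmod c * norm x"

text \<open>
  Boundedness is required separately because \<^const>\<open>onorm\<close> is a supremum of reals, which carries no
  information for an unbounded functional.
\<close>

definition state :: "('a :: complex_banach_algebra_1 \<Rightarrow> complex) \<Rightarrow> bool" where
  "state \<omega> \<longleftrightarrow> bounded_linear \<omega> \<and> (\<forall>c x. \<omega> (c *\<^sub>C x) = c * \<omega> x) \<and> onorm \<omega> = 1 \<and> \<omega> 1 = 1"

definition real_positive :: "'a :: complex_banach_algebra_1 \<Rightarrow> bool" where
  "real_positive a \<longleftrightarrow> (\<forall>\<omega>. state \<omega> \<longrightarrow> Re (\<omega> a) \<ge> 0)"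

definition idempotent :: "'a :: complex_banach_algebra_1 \<Rightarrow> bool" where
  "idempotent e \<longleftrightarrow> e * e = e"


section \<open>Complex \<open>L\<^sup>p\<close> spaces\<close>

text \<open>
  The elements of \<open>L\<^sup>p(M)\<close> are the classes, modulo equality almost everywhere, of the
  \<open>p\<close>-integrable functions. The operations and the norm are defined on chosen
  representatives; they do not depend on the choice (see the lemmas below).
\<close>

definition Lp_fun :: "real \<Rightarrow> 'x measure \<Rightarrow> ('x \<Rightarrow> complex) set" where
  "Lp_fun p M = {f \<in> borel_measurable M. integrable M (\<lambda>x. cmod (f x) powr p)}"

definition Lp_rel :: "real \<Rightarrow> 'x measure \<Rightarrow> (('x \<Rightarrow> complex) \<times> ('x \<Rightarrow> complex)) set" where
  "Lp_rel p M = {(f, g). f \<in> Lp_fun p M \<and> g \<in> Lp_fun p M \<and> (AE x in M. f x = g x)}"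

definition Lp_space :: "real \<Rightarrow> 'x measure \<Rightarrow> ('x \<Rightarrow> complex) set set" where
  "Lp_space p M = Lp_fun p M // Lp_rel p M"

definition Lp_class :: "real \<Rightarrow> 'x measure \<Rightarrow> ('x \<Rightarrow> complex) \<Rightarrow> ('x \<Rightarrow> complex) set" where
  "Lp_class p M f = Lp_rel p M `` {f}"

definition Lp_rep :: "('x \<Rightarrow> complex) set \<Rightarrow> ('x \<Rightarrow> complex)" where
  "Lp_rep F = (SOME f. f \<in> F)"

definition Lp_zero :: "real \<Rightarrow> 'x measure \<Rightarrow> ('x \<Rightarrow> complex) set" where
  "Lp_zero p M = Lp_class p M (\<lambda>x. 0)"

definition Lp_add ::
  "real \<Rightarrow> 'x measure \<Rightarrow> ('x \<Rightarrow> complex) set \<Rightarrow> ('x \<Rightarrow> complex) set \<Rightarrow> ('x \<Rightarrow> complex) set" where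
  "Lp_add p M F G = Lp_class p M (\<lambda>x. Lp_rep F x + Lp_rep G x)"

definition Lp_scale ::
  "real \<Rightarrow> 'x measure \<Rightarrow> complex \<Rightarrow> ('x \<Rightarrow> complex) set \<Rightarrow> ('x \<Rightarrow> complex) set" where
  "Lp_scale p M c F = Lp_class p M (\<lambda>x. c * Lp_rep F x)"

definition Lp_norm :: "real \<Rightarrow> 'x measure \<Rightarrow> ('x \<Rightarrow> complex) set \<Rightarrow> real" where
  "Lp_norm p M F = (LINT x|M. cmod (Lp_rep F x) powr p) powr (1 / p)"

lemma equiv_Lp_rel: "equiv (Lp_fun p M) (Lp_rel p M)"
  by (rule equivI) (auto simp: Lp_rel_def refl_on_def intro!: symI transI)

lemma Lp_rel_rep:
  assumes "f \<in> Lp_fun p M"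
  shows "(f, Lp_rep (Lp_class p M f)) \<in> Lp_rel p M"
proof -
  have "f \<in> Lp_class p M f"
    using assms by (auto simp: Lp_class_def Lp_rel_def)
  then have "Lp_rep (Lp_class p M f) \<in> Lp_class p M f"
    unfolding Lp_rep_def by (rule someI[where P = "\<lambda>g. g \<in> Lp_class p M f"])
  then show ?thesis by (simp add: Lp_class_def)
qed

lemma Lp_class_eqI:
  assumes "(f, g) \<in> Lp_rel p M"
  shows "Lp_class p M f = Lp_class p M g"
  unfolding Lp_class_def using equiv_Lp_rel assms by (rule equiv_class_eq)

lemma Lp_fun_add:
  assumes "1 \<le> p" "f \<in> Lp_fun p M" "g \<in> Lp_fun p M"
  shows "(\<lambda>x. f x + g x) \<in> Lp_fun p M"
proof -
  have bound: "cmod (a + b) powr p \<le> 2 powr p * (cmod a powr p + cmod b powr p)" for a b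
  proof -
    have "cmod (a + b) \<le> 2 * max (cmod a) (cmod b)"
      using norm_triangle_ineq[of a b] by linarith
    then have "cmod (a + b) powr p \<le> (2 * max (cmod a) (cmod b)) powr p"
      using assms(1) by (intro powr_mono2) auto
    also have "\<dots> = 2 powr p * max (cmod a) (cmod b) powr p"
      by (simp add: powr_mult)
    also have "\<dots> \<le> 2 powr p * (cmod a powr p + cmod b powr p)"
      by (intro mult_left_mono) (auto simp: max_def)
    finally show ?thesis .
  qed
  have [measurable]: "f \<in> borel_measurable M" "g \<in> borel_measurable M"
    using assms by (auto simp: Lp_fun_def)
  have "integrable M (\<lambda>x. 2 powr p * (cmod (f x) powr p + cmod (g x) powr p))"
    using assms by (auto simp: Lp_fun_def)
  then have "integrable M (\<lambda>x. cmod (f x + g x) powr p)"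
    by (rule Bochner_Integration.integrable_bound) (use bound in \<open>auto intro!: AE_I2\<close>)
  then show ?thesis by (simp add: Lp_fun_def)
qed

lemma Lp_fun_scale:
  assumes "f \<in> Lp_fun p M"
  shows "(\<lambda>x. c * f x) \<in> Lp_fun p M"
  using assms by (auto simp: Lp_fun_def norm_mult powr_mult)

lemma Lp_add_class:
  assumes "1 \<le> p" "f \<in> Lp_fun p M" "g \<in> Lp_fun p M"
  shows "Lp_add p M (Lp_class p M f) (Lp_class p M g) = Lp_class p M (\<lambda>x. f x + g x)"
proof -
  have "AE x in M. f x = Lp_rep (Lp_class p M f) x" "AE x in M. g x = Lp_rep (Lp_class p M g) x"
    using Lp_rel_rep[OF assms(2)] Lp_rel_rep[OF assms(3)] by (auto simp: Lp_rel_def)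
  then have "AE x in M. f x + g x = Lp_rep (Lp_class p M f) x + Lp_rep (Lp_class p M g) x"
    by eventually_elim simp
  then show ?thesis
    unfolding Lp_add_def using Lp_rel_rep[OF assms(2)] Lp_rel_rep[OF assms(3)] assms
    by (intro Lp_class_eqI[symmetric]) (auto simp: Lp_rel_def intro!: Lp_fun_add)
qed

lemma Lp_scale_class:
  assumes "f \<in> Lp_fun p M"
  shows "Lp_scale p M c (Lp_class p M f) = Lp_class p M (\<lambda>x. c * f x)"
  unfolding Lp_scale_def using Lp_rel_rep[OF assms] assms
  by (intro Lp_class_eqI[symmetric]) (auto simp: Lp_rel_def intro!: Lp_fun_scale)

lemma Lp_norm_class:
  assumes "f \<in> Lp_fun p M"
  shows "Lp_norm p M (Lp_class p M f) = (LINT x|M. cmod (f x) powr p) powr (1 / p)"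
proof -
  have "(LINT x|M. cmod (Lp_rep (Lp_class p M f) x) powr p) = (LINT x|M. cmod (f x) powr p)"
    using Lp_rel_rep[OF assms] by (intro integral_cong_AE) (auto simp: Lp_rel_def Lp_fun_def)
  then show ?thesis by (simp add: Lp_norm_def)
qed


section \<open>The Banach algebra of bounded operators on \<open>L\<^sup>p\<close>\<close>

text \<open>
  Operators are extensional functions on \<^const>\<open>Lp_space\<close>, so that equality of operators is HOL
  equality; composition is \<^const>\<open>compose\<close>.
\<close>

definition Lp_operators ::
  "real \<Rightarrow> 'x measure \<Rightarrow> (('x \<Rightarrow> complex) set \<Rightarrow> ('x \<Rightarrow> complex) set) set" where
  "Lp_operators p M = {T \<in> Lp_space p M \<rightarrow>\<^sub>E Lp_space p M.
     (\<forall>F \<in> Lp_space p M. \<forall>G \<in> Lp_space p M. T (Lp_add p M F G) = Lp_add p M (T F) (T G)) \<and>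
     (\<forall>c. \<forall>F \<in> Lp_space p M. T (Lp_scale p M c F) = Lp_scale p M c (T F)) \<and>
     (\<exists>K. \<forall>F \<in> Lp_space p M. Lp_norm p M (T F) \<le> K * Lp_norm p M F)}"

definition Lp_op_norm ::
  "real \<Rightarrow> 'x measure \<Rightarrow> (('x \<Rightarrow> complex) set \<Rightarrow> ('x \<Rightarrow> complex) set) \<Rightarrow> real" where
  "Lp_op_norm p M T = (SUP F \<in> {F \<in> Lp_space p M. Lp_norm p M F \<le> 1}. Lp_norm p M (T F))"

definition Lp_op_zero ::
  "real \<Rightarrow> 'x measure \<Rightarrow> (('x \<Rightarrow> complex) set \<Rightarrow> ('x \<Rightarrow> complex) set)" where
  "Lp_op_zero p M = (\<lambda>F \<in> Lp_space p M. Lp_zero p M)"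

definition Lp_op_add ::
  "real \<Rightarrow> 'x measure \<Rightarrow> (('x \<Rightarrow> complex) set \<Rightarrow> ('x \<Rightarrow> complex) set) \<Rightarrow>
   (('x \<Rightarrow> complex) set \<Rightarrow> ('x \<Rightarrow> complex) set) \<Rightarrow> (('x \<Rightarrow> complex) set \<Rightarrow> ('x \<Rightarrow> complex) set)" where
  "Lp_op_add p M S T = (\<lambda>F \<in> Lp_space p M. Lp_add p M (S F) (T F))"

definition Lp_op_scale ::
  "real \<Rightarrow> 'x measure \<Rightarrow> complex \<Rightarrow> (('x \<Rightarrow> complex) set \<Rightarrow> ('x \<Rightarrow> complex) set) \<Rightarrow>
   (('x \<Rightarrow> complex) set \<Rightarrow> ('x \<Rightarrow> complex) set)" where
  "Lp_op_scale p M c T = (\<lambda>F \<in> Lp_space p M. Lp_scale p M c (T F))"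

definition Lp_op_mult ::
  "real \<Rightarrow> 'x measure \<Rightarrow> (('x \<Rightarrow> complex) set \<Rightarrow> ('x \<Rightarrow> complex) set) \<Rightarrow>
   (('x \<Rightarrow> complex) set \<Rightarrow> ('x \<Rightarrow> complex) set) \<Rightarrow> (('x \<Rightarrow> complex) set \<Rightarrow> ('x \<Rightarrow> complex) set)" where
  "Lp_op_mult p M S T = compose (Lp_space p M) S T"

definition Lp_closed_subalgebra ::
  "real \<Rightarrow> 'x measure \<Rightarrow> (('x \<Rightarrow> complex) set \<Rightarrow> ('x \<Rightarrow> complex) set) set \<Rightarrow> bool" where
  "Lp_closed_subalgebra p M B \<longleftrightarrow>
     B \<subseteq> Lp_operators p M \<and>
     Lp_op_zero p M \<in> B \<and>
     (\<forall>S \<in> B. \<forall>T \<in> B. Lp_op_add p M S T \<in> B) \<and>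
     (\<forall>c. \<forall>T \<in> B. Lp_op_scale p M c T \<in> B) \<and>
     (\<forall>S \<in> B. \<forall>T \<in> B. Lp_op_mult p M S T \<in> B) \<and>
     (\<forall>S T. (\<forall>n :: nat. S n \<in> B) \<longrightarrow> T \<in> Lp_operators p M \<longrightarrow>
        (\<lambda>n. Lp_op_norm p M (Lp_op_add p M (S n) (Lp_op_scale p M (-1) T))) \<longlonglongrightarrow> 0 \<longrightarrow> T \<in> B)"

definition Lp_isometric_isomorphism ::
  "real \<Rightarrow> 'x measure \<Rightarrow> (('x \<Rightarrow> complex) set \<Rightarrow> ('x \<Rightarrow> complex) set) set \<Rightarrow>
   ('a :: complex_banach_algebra_1 \<Rightarrow> (('x \<Rightarrow> complex) set \<Rightarrow> ('x \<Rightarrow> complex) set)) \<Rightarrow> bool" where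
  "Lp_isometric_isomorphism p M B \<pi> \<longleftrightarrow>
     bij_betw \<pi> UNIV B \<and>
     (\<forall>a b. \<pi> (a + b) = Lp_op_add p M (\<pi> a) (\<pi> b)) \<and>
     (\<forall>c a. \<pi> (c *\<^sub>C a) = Lp_op_scale p M c (\<pi> a)) \<and>
     (\<forall>a b. \<pi> (a * b) = Lp_op_mult p M (\<pi> a) (\<pi> b)) \<and>
     (\<forall>a. Lp_op_norm p M (\<pi> a) = norm a)"

text \<open>
  The algebra is the whole type \<open>'a\<close>; the measure space lives on an arbitrary type \<open>'x\<close>. The
  isomorphism is not required to send \<open>1\<close> to the identity operator of \<open>L\<^sup>p(M)\<close>.
\<close>

definition Lp_operator_algebra ::
  "real \<Rightarrow> 'x itself \<Rightarrow> 'a :: complex_banach_algebra_1 itself \<Rightarrow> bool" where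
  "Lp_operator_algebra p X A \<longleftrightarrow>
     (\<exists>(M :: 'x measure) B (\<pi> :: 'a \<Rightarrow> _).
        Lp_closed_subalgebra p M B \<and> Lp_isometric_isomorphism p M B \<pi>)"

end

theory Submission
  imports Defs
begin

text \<open>
  Put \<open>f = 1 - e\<close>, so that \<open>\<phi> f = 1\<close>. If for every \<open>\<eta> > 0\<close> some \<open>t > 0\<close> satisfies
  \<open>norm (f + t b) \<le> 1 + \<eta> t\<close>, then \<open>Re (\<phi> b) \<le> 0\<close>; when this holds for all complex multiples of
  \<open>b\<close>, it gives \<open>\<phi> b = 0\<close>. By Hahn--Banach, real positivity of \<open>e\<close> makes \<open>f\<close> a contraction.
  Let \<open>x\<close> be in the unit ball of \<open>L\<^sup>p\<close>. For \<open>b = a e\<close>, uniform convexity shows that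
  \<open>e x\<close> is small whenever \<open>norm (f x)\<close> is close to \<open>1\<close>, because \<open>(x + f x) / 2\<close> has
  norm at least \<open>norm (f x)\<close>. For \<open>b = e a\<close>, uniform smoothness bounds
  \<open>norm (f x + t e a x)\<close>, because \<open>norm (f x - t e a x) \<ge> norm (f x)\<close>. Both properties of
  \<open>L\<^sup>p\<close> enter as integrated scalar inequalities for \<open>p\<close>-th powers.
\<close>

section \<open>Scalar inequalities for \<open>p\<close>-th powers\<close>

text \<open>The derivative of \<open>y powr p\<close> is strictly increasing on the positive reals,
  so the mean value theorem puts the graph strictly above each tangent. The point \<open>0\<close>
  is treated directly, since the derivative is taken only at positive arguments.\<close>

lemma powr_tangent:
  fixes p x m :: real
  assumes p: "1 < p" and x: "0 \<le> x" and m: "0 \<le> m" and ne: "x \<noteq> m"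
  shows "m powr p + p * m powr (p - 1) * (x - m) < x powr p"
proof (cases "m = 0 \<or> x = 0")
  case True
  show ?thesis
  proof (cases "m = 0")
    case True
    then show ?thesis using assms by auto
  next
    case False
    then have "m powr (p - 1) * m = m powr p"
      using m by (simp add: powr_mult_base mult.commute)
    moreover have "m powr p < p * m powr p" using p False m by simp
    ultimately show ?thesis using True False by (simp add: mult.assoc)
  qed
next
  case False
  then have xm: "0 < x" "0 < m" using x m by auto
  have der: "((\<lambda>y. y powr p) has_real_derivative p * y powr (p - 1)) (at y)" if "0 < y" for y
    using that by (auto intro!: derivative_eq_intros)
  show ?thesis
  proof (cases "m < x")
    case True
    obtain z where z: "m < z" "z < x" "x powr p - m powr p = (x - m) * (p * z powr (p - 1))"
      using MVT2[OF True, of "\<lambda>y. y powr p" "\<lambda>y. p * y powr (p - 1)"] der xm by force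
    have "m powr (p - 1) < z powr (p - 1)" using z xm p by (intro powr_less_mono2) auto
    then have "p * m powr (p - 1) * (x - m) < p * z powr (p - 1) * (x - m)"
      using True p by simp
    then show ?thesis using z(3) by (simp add: algebra_simps)
  next
    case False
    then have "x < m" using ne by simp
    then obtain z where z: "x < z" "z < m" "m powr p - x powr p = (m - x) * (p * z powr (p - 1))"
      using MVT2[of x m "\<lambda>y. y powr p" "\<lambda>y. p * y powr (p - 1)"] der xm by force
    have "z powr (p - 1) < m powr (p - 1)" using z xm p by (intro powr_less_mono2) auto
    then have "p * z powr (p - 1) * (m - x) < p * m powr (p - 1) * (m - x)"
      using \<open>x < m\<close> p by simp
    then show ?thesis using z(3) by (simp add: algebra_simps)
  qed
qed

lemma powr_tangent_le:
  fixes p x m :: real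
  assumes "1 < p" "0 \<le> x" "0 \<le> m"
  shows "m powr p + p * m powr (p - 1) * (x - m) \<le> x powr p"
  using powr_tangent[OF assms] by (cases "x = m") auto

lemma powr_midpoint_less:
  fixes p x y :: real
  assumes "1 < p" "0 \<le> x" "0 \<le> y" "x \<noteq> y"
  shows "((x + y) / 2) powr p < (x powr p + y powr p) / 2"
proof -
  let ?m = "(x + y) / 2"
  have "?m powr p + p * ?m powr (p - 1) * (x - ?m) < x powr p"
    "?m powr p + p * ?m powr (p - 1) * (y - ?m) < y powr p"
    using assms by (auto intro!: powr_tangent)
  then have "2 * ?m powr p + p * ?m powr (p - 1) * ((x - ?m) + (y - ?m)) < x powr p + y powr p"
    unfolding distrib_left by linarith
  then show ?thesis by simp
qed

text \<open>In the weighted average of the tangent inequalities at \<open>?m\<close> the slope terms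
  cancel.\<close>

lemma powr_convex_combination:
  fixes p x y \<alpha> \<beta> :: real
  assumes "1 < p" "0 \<le> x" "0 \<le> y" "0 \<le> \<alpha>" "0 \<le> \<beta>" "\<alpha> + \<beta> = 1"
  shows "(\<alpha> * x + \<beta> * y) powr p \<le> \<alpha> * x powr p + \<beta> * y powr p"
proof -
  let ?m = "\<alpha> * x + \<beta> * y"
  let ?d = "p * ?m powr (p - 1)"
  have m: "0 \<le> ?m" using assms by simp
  have "\<alpha> * (?m powr p + ?d * (x - ?m)) + \<beta> * (?m powr p + ?d * (y - ?m))
      \<le> \<alpha> * x powr p + \<beta> * y powr p"
    using assms m by (intro add_mono mult_left_mono powr_tangent_le) auto
  moreover have "\<alpha> * (?m powr p + ?d * (x - ?m)) + \<beta> * (?m powr p + ?d * (y - ?m))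
      = (\<alpha> + \<beta>) * ?m powr p + ?d * (?m - (\<alpha> + \<beta>) * ?m)"
    by (simp only: algebra_simps)
  ultimately show ?thesis using assms by simp
qed

text \<open>With \<open>k = \<eta> * t\<close>, convexity is applied to
  \<open>(1 + k) * cmod u\<close> and \<open>(1 + k) * (cmod w / \<eta>)\<close> with weights
  \<open>1 / (1 + k)\<close> and \<open>k / (1 + k)\<close>. The prefactor is then
  \<open>(1 + k) powr (p - 1)\<close>, so a bracket of size at most \<open>1 + k\<close> yields
  exactly \<open>(1 + k) powr p\<close>.\<close>

lemma cmod_add_powr_le:
  fixes u w :: complex
  assumes p: "1 < p" and \<eta>: "0 < \<eta>" and t: "0 < t"
  shows "cmod (u + of_real t * w) powr p
    \<le> (1 + \<eta> * t) powr (p - 1) * (cmod u powr p + \<eta> powr (1 - p) * t * cmod w powr p)"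
proof -
  define k where "k = \<eta> * t"
  have k: "0 < k" using \<eta> t by (simp add: k_def)
  have "cmod (u + of_real t * w) \<le> cmod u + t * cmod w"
    using norm_triangle_ineq[of u "of_real t * w"] t by (simp add: norm_mult)
  also have "\<dots> = 1 / (1 + k) * ((1 + k) * cmod u) + k / (1 + k) * ((1 + k) * (cmod w / \<eta>))"
  proof -
    have "1 / (1 + k) * ((1 + k) * x) = x" "k / (1 + k) * ((1 + k) * y) = k * y" for x y
      using k by (simp_all add: field_simps)
    then show ?thesis using \<eta> by (simp add: k_def)
  qed
  finally have "cmod (u + of_real t * w) powr p
      \<le> (1 / (1 + k) * ((1 + k) * cmod u) + k / (1 + k) * ((1 + k) * (cmod w / \<eta>))) powr p"
    using p by (intro powr_mono2) auto
  also have "\<dots> \<le> 1 / (1 + k) * ((1 + k) * cmod u) powr p + k / (1 + k) * ((1 + k) * (cmod w / \<eta>)) powr p"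
    using k \<eta> p by (intro powr_convex_combination) (auto simp: field_simps)
  also have "\<dots> = (1 + k) powr p / (1 + k) * (cmod u powr p + k * (cmod w powr p / \<eta> powr p))"
    proof -
    have "((1 + k) * x) powr p = (1 + k) powr p * x powr p" if "0 \<le> x" for x
      using k that by (simp add: powr_mult)
    then have "((1 + k) * cmod u) powr p = (1 + k) powr p * cmod u powr p"
      "((1 + k) * (cmod w / \<eta>)) powr p = (1 + k) powr p * (cmod w powr p / \<eta> powr p)"
      using \<eta> by (simp_all add: powr_divide)
    then show ?thesis by (simp only:) (simp add: algebra_simps add_divide_distrib)
  qed
  also have "(1 + k) powr p / (1 + k) = (1 + k) powr (p - 1)"
    using k by (simp add: powr_diff)
  also have "k * (cmod w powr p / \<eta> powr p) = \<eta> powr (1 - p) * t * cmod w powr p"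
    using \<eta> by (simp add: k_def powr_diff)
  finally show ?thesis by (simp add: k_def)
qed

text \<open>The parallelogram law gives strictness when the moduli agree; otherwise it comes from
  strict convexity of the real power after the triangle inequality.\<close>

lemma cmod_midpoint_powr_less:
  fixes a b :: complex
  assumes p: "1 < p" and ne: "a \<noteq> b"
  shows "cmod ((a + b) / 2) powr p < (cmod a powr p + cmod b powr p) / 2"
proof (cases "cmod a = cmod b")
  case True
  have "(cmod (a + b))\<^sup>2 + (cmod (a - b))\<^sup>2 = 2 * (cmod a)\<^sup>2 + 2 * (cmod b)\<^sup>2"
    by (simp only: cmod_power2) (simp add: algebra_simps power2_eq_square)
  moreover have "(cmod (a - b))\<^sup>2 > 0" using ne by (simp only: zero_less_power2 norm_eq_zero) simp
  ultimately have "(cmod (a + b))\<^sup>2 < (2 * cmod a)\<^sup>2"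
    unfolding True power2_eq_square by linarith
  then have "cmod (a + b) < 2 * cmod a" by (rule power2_less_imp_less) simp
  then have "cmod ((a + b) / 2) powr p < cmod a powr p"
    using p by (intro powr_less_mono2) (auto simp: norm_divide)
  then show ?thesis using True by simp
next
  case False
  have "cmod ((a + b) / 2) powr p \<le> ((cmod a + cmod b) / 2) powr p"
    using p norm_triangle_ineq[of a b] by (intro powr_mono2) (auto simp: norm_divide)
  also have "\<dots> < (cmod a powr p + cmod b powr p) / 2"
    using p False by (intro powr_midpoint_less) auto
  finally show ?thesis .
qed

text \<open>Division by \<open>max (cmod a) (cmod b)\<close> reduces an inequality between functions
  homogeneous of degree \<open>p\<close> to a compact set of pairs. The pair of zeros cannot be
  rescaled and is a separate assumption.\<close>

lemma cmod_powr_homogeneous_le: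
  fixes F G :: "complex \<Rightarrow> complex \<Rightarrow> real"
  assumes homF: "\<And>m a b. 0 < m \<Longrightarrow> F (of_real m * a) (of_real m * b) = m powr p * F a b"
    and homG: "\<And>m a b. 0 < m \<Longrightarrow> G (of_real m * a) (of_real m * b) = m powr p * G a b"
    and le: "\<And>a b. max (cmod a) (cmod b) = 1 \<Longrightarrow> F a b \<le> G a b"
    and zero: "F 0 0 \<le> G 0 0"
  shows "F a b \<le> G a b"
proof (cases "a = 0 \<and> b = 0")
  case True
  then show ?thesis using zero by simp
next
  case False
  define m where "m = max (cmod a) (cmod b)"
  have m: "0 < m" using False by (auto simp: m_def less_max_iff_disj)
  have "max (cmod (a / of_real m)) (cmod (b / of_real m)) = m / m"
    using m by (auto simp: norm_divide m_def max_def divide_right_mono field_simps)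
  then have "F (a / of_real m) (b / of_real m) \<le> G (a / of_real m) (b / of_real m)"
    using m by (intro le) simp
  then have "m powr p * F (a / of_real m) (b / of_real m) \<le> m powr p * G (a / of_real m) (b / of_real m)"
    by (intro mult_left_mono) auto
  then show ?thesis using m by (simp flip: homF homG)
qed

text \<open>The midpoint deficit \<open>D\<close> vanishes only on the diagonal, so by compactness
  it has a positive lower bound on the normalised pairs in \<open>K\<close>, which are far apart.
  There a large multiple of \<open>D\<close> dominates; for close pairs the
  \<open>\<epsilon>\<close> term suffices.\<close>

lemma cmod_powr_uniformly_convex:
  assumes p: "1 < p" and \<epsilon>: "0 < \<epsilon>"
  obtains C where "0 < C"
    "\<And>a b :: complex. cmod (a - b) powr p \<le> \<epsilon> * (cmod a powr p + cmod b powr p)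
       + C * ((cmod a powr p + cmod b powr p) / 2 - cmod ((a + b) / 2) powr p)"
proof -
  define D where "D z = (cmod (fst z) powr p + cmod (snd z) powr p) / 2
    - cmod ((fst z + snd z) / 2) powr p" for z :: "complex \<times> complex"
  define K where "K = {z :: complex \<times> complex. max (cmod (fst z)) (cmod (snd z)) = 1
    \<and> \<epsilon> \<le> cmod (fst z - snd z) powr p}"
  have cont: "continuous_on UNIV D"
    unfolding D_def using p by (intro continuous_intros continuous_on_powr') auto
  have "closed K"
    unfolding K_def using p
    by (intro closed_Collect_conj closed_Collect_eq closed_Collect_le continuous_intros continuous_on_powr') auto
  moreover have "bounded K"
  proof (rule boundedI)
    fix z assume "z \<in> K"
    then show "norm z \<le> 1 + 1"
      using norm_Pair_le[of "fst z" "snd z"] by (auto simp: K_def max_def split: if_splits)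
  qed
  ultimately have K: "compact K" by (simp add: compact_eq_bounded_closed)
  have D_nonneg: "0 \<le> D z" for z
    using cmod_midpoint_powr_less[OF p, of "fst z" "snd z"]
    by (cases "fst z = snd z") (auto simp: D_def)
  obtain \<delta> where \<delta>: "0 < \<delta>" "\<And>z. z \<in> K \<Longrightarrow> \<delta> \<le> D z"
  proof (cases "K = {}")
    case True
    then show ?thesis using that[of 1] by simp
  next
    case False
    then obtain z where z: "z \<in> K" "\<And>w. w \<in> K \<Longrightarrow> D z \<le> D w"
      using continuous_attains_inf[OF K False continuous_on_subset[OF cont]] by auto
    have "fst z \<noteq> snd z" using z(1) \<epsilon> by (auto simp: K_def)
    then have "0 < D z" using cmod_midpoint_powr_less[OF p, of "fst z" "snd z"] by (simp add: D_def)
    then show ?thesis using z(2) that by blast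
  qed
  \<comment> \<open>For normalised pairs the left side is at most \<open>2 powr p\<close>, and this
    choice makes \<open>C * \<delta>\<close> equal to that bound.\<close>
  define C where "C = 2 powr p / \<delta>"
  have C: "0 < C" using \<delta> by (simp add: C_def)
  have "cmod (a - b) powr p \<le> \<epsilon> * (cmod a powr p + cmod b powr p)
       + C * ((cmod a powr p + cmod b powr p) / 2 - cmod ((a + b) / 2) powr p)" for a b :: complex
  proof (rule cmod_powr_homogeneous_le[where p = p
      and F = "\<lambda>a b. cmod (a - b) powr p"
      and G = "\<lambda>a b. \<epsilon> * (cmod a powr p + cmod b powr p) + C * ((cmod a powr p + cmod b powr p) / 2 - cmod ((a + b) / 2) powr p)"])
    fix m :: real and a b :: complex assume m: "0 < m"
    show "cmod (of_real m * a - of_real m * b) powr p = m powr p * cmod (a - b) powr p"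
      using m by (simp add: norm_mult powr_mult flip: right_diff_distrib)
    have "cmod ((of_real m * a + of_real m * b) / 2) powr p = m powr p * cmod ((a + b) / 2) powr p"
      using m by (simp add: norm_mult norm_divide powr_mult powr_divide flip: distrib_left)
    moreover have "cmod (of_real m * z) powr p = m powr p * cmod z powr p" for z
      using m by (simp add: norm_mult powr_mult)
    ultimately show "\<epsilon> * (cmod (of_real m * a) powr p + cmod (of_real m * b) powr p)
       + C * ((cmod (of_real m * a) powr p + cmod (of_real m * b) powr p) / 2
              - cmod ((of_real m * a + of_real m * b) / 2) powr p) =
      m powr p * (\<epsilon> * (cmod a powr p + cmod b powr p)
       + C * ((cmod a powr p + cmod b powr p) / 2 - cmod ((a + b) / 2) powr p))"
      by (simp only:) (simp add: algebra_simps)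
  next
    fix a b :: complex assume ab: "max (cmod a) (cmod b) = 1"
    have one: "1 \<le> cmod a powr p + cmod b powr p"
      using ab by (auto simp: max_def split: if_splits)
    have CD: "0 \<le> C * D (a, b)" using C D_nonneg by simp
    show "cmod (a - b) powr p \<le> \<epsilon> * (cmod a powr p + cmod b powr p)
       + C * ((cmod a powr p + cmod b powr p) / 2 - cmod ((a + b) / 2) powr p)"
    proof (cases "\<epsilon> \<le> cmod (a - b) powr p")
      case True
      then have "C * \<delta> \<le> C * D (a, b)"
        using \<delta>(2)[of "(a, b)"] ab C by (simp add: K_def)
      moreover have "cmod (a - b) \<le> 2"
        using norm_triangle_ineq4[of a b] ab by (auto simp: max_def split: if_splits)
      then have "cmod (a - b) powr p \<le> C * \<delta>"
        using p \<delta> by (auto simp: C_def intro!: powr_mono2)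
      moreover have "0 \<le> \<epsilon> * (cmod a powr p + cmod b powr p)" using \<epsilon> by simp
      ultimately show ?thesis by (simp add: D_def)
    next
      case False
      then show ?thesis
        using CD mult_left_mono[OF one, of \<epsilon>] \<epsilon> unfolding D_def fst_conv snd_conv by linarith
    qed
  qed simp
  then show ?thesis using C that by blast
qed

text \<open>The first-order parts of the two sides add up to a multiple of
  \<open>r powr (p - 1) * (r1 + r2 - 2 * r)\<close>. For \<open>r\<close> away from \<open>0\<close>
  the parallelogram law makes the second factor quadratic in \<open>t\<close>; near
  \<open>0\<close>, where the modulus is not differentiable, the first factor is small
  instead.\<close>

lemma cmod_powr_uniformly_smooth:
  assumes p: "1 < p" and \<eta>: "0 < \<eta>"
  obtains t where "0 < t"
    "\<And>a b :: complex. cmod (a + of_real t * b) powr p + cmod (a - of_real t * b) powr p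
       - 2 * cmod a powr p \<le> \<eta> * t * (cmod a powr p + cmod b powr p)"
proof -
  \<comment> \<open>Four errors of size \<open>p * \<epsilon> * t\<close> arise below, two from
    \<open>one_side\<close> and two from \<open>mid\<close>; together they make
    \<open>\<eta> * t\<close>.\<close>
  define \<epsilon> where "\<epsilon> = \<eta> / (4 * p)"
  have \<epsilon>: "0 < \<epsilon>" using \<eta> p by (simp add: \<epsilon>_def)
  have "uniformly_continuous_on {0..2} (\<lambda>x::real. x powr (p - 1))"
    using p by (intro compact_uniformly_continuous continuous_on_powr' continuous_intros) auto
  then obtain d where d: "0 < d" "\<And>x y. x \<in> {0..2} \<Longrightarrow> y \<in> {0..2} \<Longrightarrow> \<bar>x - y\<bar> < d \<Longrightarrow>
      \<bar>x powr (p - 1) - y powr (p - 1)\<bar> < \<epsilon>"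
    unfolding uniformly_continuous_on_def dist_real_def using \<epsilon> by metis
  \<comment> \<open>The threshold for \<open>r\<close> below which \<open>r powr (p - 1)\<close> is
    at most \<open>\<epsilon>\<close>.\<close>
  define c where "c = \<epsilon> powr (1 / (p - 1))"
  have c: "0 < c" "c powr (p - 1) = \<epsilon>" using \<epsilon> p by (auto simp: c_def powr_powr)
  \<comment> \<open>The bound \<open>1\<close> keeps all moduli in \<open>{0..2}\<close>,
    \<open>d / 2\<close> permits the uniform continuity estimate, and \<open>c * \<epsilon>\<close>
    makes \<open>t * t / c\<close> at most \<open>\<epsilon> * t\<close>.\<close>
  define t where "t = min 1 (min (d / 2) (c * \<epsilon>))"
  have t: "0 < t" "t \<le> 1" "t < d" "t \<le> c * \<epsilon>" using d c \<epsilon> by (auto simp: t_def)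
  have "cmod (a + of_real t * b) powr p + cmod (a - of_real t * b) powr p
       - 2 * cmod a powr p \<le> \<eta> * t * (cmod a powr p + cmod b powr p)" for a b :: complex
  proof (rule cmod_powr_homogeneous_le[where p = p
      and F = "\<lambda>a b. cmod (a + of_real t * b) powr p + cmod (a - of_real t * b) powr p - 2 * cmod a powr p"
      and G = "\<lambda>a b. \<eta> * t * (cmod a powr p + cmod b powr p)"])
    fix m :: real and a b :: complex assume m: "0 < m"
    have "cmod (of_real m * a + of_real t * (of_real m * b)) powr p = m powr p * cmod (a + of_real t * b) powr p"
      "cmod (of_real m * a - of_real t * (of_real m * b)) powr p = m powr p * cmod (a - of_real t * b) powr p"
      using m by (simp_all add: norm_mult powr_mult mult.left_commute[of _ "of_real m"]
        flip: distrib_left right_diff_distrib)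
    moreover have hom: "cmod (of_real m * z) powr p = m powr p * cmod z powr p" for z
      using m by (simp add: norm_mult powr_mult)
    ultimately show "cmod (of_real m * a + of_real t * (of_real m * b)) powr p
        + cmod (of_real m * a - of_real t * (of_real m * b)) powr p - 2 * cmod (of_real m * a) powr p
      = m powr p * (cmod (a + of_real t * b) powr p + cmod (a - of_real t * b) powr p - 2 * cmod a powr p)"
      by (simp add: algebra_simps)
    show "\<eta> * t * (cmod (of_real m * a) powr p + cmod (of_real m * b) powr p)
      = m powr p * (\<eta> * t * (cmod a powr p + cmod b powr p))"
      by (simp only: hom) (simp add: algebra_simps)
  next
    fix a b :: complex assume ab: "max (cmod a) (cmod b) = 1"
    define r r1 r2 where "r = cmod a" and "r1 = cmod (a + of_real t * b)" and "r2 = cmod (a - of_real t * b)"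
    have nn: "0 \<le> r" "0 \<le> r1" "0 \<le> r2" "r \<le> 1" "cmod b \<le> 1"
      using ab by (auto simp: r_def r1_def r2_def)
    have tb: "cmod (of_real t * b) \<le> t" using nn t by (simp add: norm_mult)
    have near: "\<bar>r1 - r\<bar> \<le> t" "\<bar>r2 - r\<bar> \<le> t"
      using tb norm_triangle_ineq3[of "a + of_real t * b" a] norm_triangle_ineq3[of "a - of_real t * b" a]
      by (auto simp: r_def r1_def r2_def)
    have one_side: "s powr p - r powr p \<le> p * r powr (p - 1) * (s - r) + p * \<epsilon> * t"
      if s: "0 \<le> s" "\<bar>s - r\<bar> \<le> t" for s
    proof -
      \<comment> \<open>An upper bound needs the tangent at \<open>s\<close>, evaluated at
        \<open>r\<close>; its slope is then replaced by the slope at \<open>r\<close>.\<close>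
      have "s powr p - r powr p \<le> p * s powr (p - 1) * (s - r)"
        using powr_tangent_le[OF p nn(1) s(1)] by (simp add: algebra_simps)
      also have "\<dots> = p * r powr (p - 1) * (s - r) + p * ((s powr (p - 1) - r powr (p - 1)) * (s - r))"
        by (simp add: algebra_simps)
      also have "(s powr (p - 1) - r powr (p - 1)) * (s - r) \<le> \<epsilon> * t"
      proof -
        have "\<bar>s powr (p - 1) - r powr (p - 1)\<bar> < \<epsilon>"
          using s nn t by (intro d(2)) auto
        then have "\<bar>s powr (p - 1) - r powr (p - 1)\<bar> * \<bar>s - r\<bar> \<le> \<epsilon> * t"
          using s by (intro mult_mono) auto
        then show ?thesis by (simp flip: abs_mult)
      qed
      finally show ?thesis using p by simp
    qed
    \<comment> \<open>The two squares give
      \<open>4 * r * (r1 + r2) \<le> 4 * r * r + (r1 + r2) * (r1 + r2)\<close> and bound the last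
      product by twice the sum of the squares of \<open>r1\<close> and \<open>r2\<close>, which the
      parallelogram law evaluates.\<close>
    have r_le: "r * (r1 + r2 - 2 * r) \<le> t\<^sup>2"
    proof -
      have "r1\<^sup>2 + r2\<^sup>2 = 2 * r\<^sup>2 + 2 * (cmod (of_real t * b))\<^sup>2"
        unfolding r_def r1_def r2_def by (simp only: cmod_power2) (simp add: algebra_simps power2_eq_square)
      moreover have "(cmod (of_real t * b))\<^sup>2 \<le> t\<^sup>2" using tb by (intro power_mono) auto
      moreover have "0 \<le> (r1 - r2)\<^sup>2" "0 \<le> (2 * r - (r1 + r2))\<^sup>2" by simp_all
      ultimately show ?thesis by (simp add: power2_eq_square algebra_simps)
    qed
    have mid: "r powr (p - 1) * (r1 + r2 - 2 * r) \<le> 2 * \<epsilon> * t"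
    proof (cases "r1 + r2 - 2 * r \<le> 0 \<or> r \<le> c")
      case True
      then show ?thesis
      proof
        assume "r1 + r2 - 2 * r \<le> 0"
        then have "r powr (p - 1) * (r1 + r2 - 2 * r) \<le> 0" by (intro mult_nonneg_nonpos) auto
        also have "0 \<le> 2 * \<epsilon> * t" using \<epsilon> t by simp
        finally show ?thesis .
      next
        assume "r \<le> c"
        then have "r powr (p - 1) \<le> \<epsilon>"
          using powr_mono2[of "p - 1" r c] p nn c by simp
        then have "r powr (p - 1) * \<bar>r1 + r2 - 2 * r\<bar> \<le> \<epsilon> * (2 * t)"
          using near \<epsilon> by (intro mult_mono) auto
        then show ?thesis
          using mult_left_mono[OF abs_ge_self, of "r powr (p - 1)" "r1 + r2 - 2 * r"] by simp
      qed
    next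
      case False
      have "r powr (p - 1) * (r1 + r2 - 2 * r) \<le> 1 * (r1 + r2 - 2 * r)"
        using False p nn by (intro mult_right_mono) (auto intro: powr_le1)
      also have "\<dots> \<le> \<epsilon> * t"
      proof -
        have "c * (r1 + r2 - 2 * r) \<le> r * (r1 + r2 - 2 * r)"
          using False by (intro mult_right_mono) auto
        also have "\<dots> \<le> t * t" using r_le by (simp add: power2_eq_square)
        also have "\<dots> \<le> (c * \<epsilon>) * t" using t by (intro mult_right_mono) auto
        finally show ?thesis using c by (simp add: mult.assoc)
      qed
      also have "\<epsilon> * t \<le> 2 * \<epsilon> * t" using \<epsilon> t by simp
      finally show ?thesis .
    qed
    have "r1 powr p + r2 powr p - 2 * r powr p
        \<le> p * (r powr (p - 1) * (r1 + r2 - 2 * r)) + 2 * (p * \<epsilon> * t)"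
      using one_side[OF nn(2) near(1)] one_side[OF nn(3) near(2)] by (simp add: algebra_simps)
    also have "\<dots> \<le> p * (2 * \<epsilon> * t) + 2 * (p * \<epsilon> * t)"
      using mid p by simp
    also have "\<dots> = \<eta> * t" using p by (simp add: \<epsilon>_def)
    also have "\<dots> \<le> \<eta> * t * (cmod a powr p + cmod b powr p)"
    proof -
      have "1 \<le> cmod a powr p + cmod b powr p"
        using ab by (auto simp: max_def split: if_splits)
      then show ?thesis using \<eta> t by simp
    qed
    finally show "cmod (a + of_real t * b) powr p + cmod (a - of_real t * b) powr p
       - 2 * cmod a powr p \<le> \<eta> * t * (cmod a powr p + cmod b powr p)"
      by (simp add: r_def r1_def r2_def)
  qed simp
  then show ?thesis using t that by blast
qed

section \<open>Sublinear functionals and states\<close>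

definition sublinear :: "('a :: real_vector \<Rightarrow> real) \<Rightarrow> bool" where
  "sublinear q \<longleftrightarrow> (\<forall>x y. q (x + y) \<le> q x + q y) \<and> (\<forall>c x. 0 \<le> c \<longrightarrow> q (c *\<^sub>R x) = c * q x)"

text \<open>Scaling back by \<open>inverse c\<close> turns the one-sided inequality into an
  equality.\<close>

lemma sublinearI:
  assumes add: "\<And>x y. q (x + y) \<le> q x + q y"
    and zero: "q 0 = 0"
    and scale: "\<And>c x. 0 < c \<Longrightarrow> q (c *\<^sub>R x) \<le> c * q x"
  shows "sublinear q"
proof -
  have "q (c *\<^sub>R x) = c * q x" if "0 \<le> c" for c x
  proof (cases "c = 0")
    case False
    then have c: "0 < c" using that by simp
    then have "q (inverse c *\<^sub>R (c *\<^sub>R x)) \<le> inverse c * q (c *\<^sub>R x)" by (intro scale) simp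
    then have "c * q x \<le> q (c *\<^sub>R x)" using c by (simp add: field_simps)
    then show ?thesis using scale[OF c, of x] by simp
  qed (simp add: zero)
  then show ?thesis using add by (simp add: sublinear_def)
qed

lemma sublinear_add: "sublinear q \<Longrightarrow> q (x + y) \<le> q x + q y"
  and sublinear_scale: "sublinear q \<Longrightarrow> 0 \<le> c \<Longrightarrow> q (c *\<^sub>R x) = c * q x"
  by (auto simp: sublinear_def)

lemma sublinear_zero: "sublinear q \<Longrightarrow> q 0 = 0"
  using sublinear_scale[of q 0 0] by simp

lemma sublinear_minus: "sublinear q \<Longrightarrow> - q (- x) \<le> q x"
  using sublinear_add[of q x "- x"] sublinear_zero[of q] by simp

text \<open>Subadditivity rests on comparability: in \<open>q x + r y\<close> the smaller of
  \<open>q\<close> and \<open>r\<close> can serve at both points.\<close>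

lemma sublinear_chain_inf:
  assumes sub: "\<forall>q\<in>C. sublinear q" and ne: "C \<noteq> {}"
    and chain: "\<forall>q\<in>C. \<forall>r\<in>C. q \<le> r \<or> r \<le> q"
  shows "sublinear (\<lambda>x. INF q\<in>C. q x)" "\<And>q x. q \<in> C \<Longrightarrow> (INF q\<in>C. q x) \<le> q x"
proof -
  have q: "sublinear q" if "q \<in> C" for q using sub that by blast
  obtain q0 where q0: "q0 \<in> C" using ne by blast
  \<comment> \<open>One fixed \<open>q0\<close> gives the bound: members above it are at least
    \<open>q0 x\<close>, and members below it satisfy
    \<open>q x \<ge> - q (- x) \<ge> - q0 (- x)\<close>.\<close>
  have bdd: "bdd_below ((\<lambda>q. q x) ` C)" for x
  proof (rule bdd_belowI2)
    fix q assume "q \<in> C"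
    then have "- q (- x) \<le> q x" "- q0 (- x) \<le> q0 x" "q \<le> q0 \<or> q0 \<le> q"
      using sublinear_minus q q0 chain by blast+
    then show "min (- q0 (- x)) (q0 x) \<le> q x"
      by (smt (verit) le_funD min_le_iff_disj)
  qed
  show lower: "(INF q\<in>C. q x) \<le> q x" if "q \<in> C" for q x
    by (rule cINF_lower[OF bdd that])
  show "sublinear (\<lambda>x. INF q\<in>C. q x)"
  proof (rule sublinearI)
    show "(INF q\<in>C. q 0) = (0::real)" using q ne by (simp add: sublinear_zero cong: INF_cong)
  next
    fix c :: real and x assume c: "0 < c"
    have "(INF q\<in>C. q (c *\<^sub>R x)) / c \<le> (INF q\<in>C. q x)"
    proof (rule cINF_greatest[OF ne])
      fix r assume "r \<in> C"
      then show "(INF q\<in>C. q (c *\<^sub>R x)) / c \<le> r x"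
        using lower[of r "c *\<^sub>R x"] q c by (simp add: sublinear_scale field_simps)
    qed
    then show "(INF q\<in>C. q (c *\<^sub>R x)) \<le> c * (INF q\<in>C. q x)" using c by (simp add: field_simps)
  next
    fix x y
    let ?I = "INF q\<in>C. q (x + y)"
    have I: "?I \<le> q x + r y" if "q \<in> C" "r \<in> C" for q r
      using chain[rule_format, OF that]
    proof
      assume "q \<le> r"
      then show ?thesis
        using lower[of q "x + y"] sublinear_add[OF q, of q x y] that le_funD[of q r y] by fastforce
    next
      assume "r \<le> q"
      then show ?thesis
        using lower[of r "x + y"] sublinear_add[OF q, of r x y] that le_funD[of r q x] by fastforce
    qed
    have "?I - q x \<le> (INF q\<in>C. q y)" if "q \<in> C" for q
      using I[OF that] by (intro cINF_greatest[OF ne]) (simp add: algebra_simps)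
    then have "?I - (INF q\<in>C. q y) \<le> (INF q\<in>C. q x)"
      by (intro cINF_greatest[OF ne]) (simp add: algebra_simps)
    then show "?I \<le> (INF q\<in>C. q x) + (INF q\<in>C. q y)" by simp
  qed
qed

text \<open>The auxiliary functional in the proof that a minimal sublinear functional is linear: it lies below
  \<open>q\<close>, so by minimality it equals \<open>q\<close>, and \<open>t = 1\<close> gives \<open>q x + q y \<le> q (x + y)\<close>.\<close>

lemma sublinear_shift:
  fixes q :: "'a :: real_vector \<Rightarrow> real" and y :: 'a
  assumes q: "sublinear q"
  defines "r \<equiv> \<lambda>x. INF t\<in>{0..}. q (x + t *\<^sub>R y) - t * q y"
  shows "sublinear r" "\<And>x t. 0 \<le> t \<Longrightarrow> r x \<le> q (x + t *\<^sub>R y) - t * q y"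
proof -
  have r_eq: "r x = (INF t\<in>{0..}. q (x + t *\<^sub>R y) - t * q y)" for x by (simp add: r_def)
  have "bdd_below ((\<lambda>t. q (x + t *\<^sub>R y) - t * q y) ` {0..})" for x
  proof (rule bdd_belowI2)
    fix t :: real assume "t \<in> {0..}"
    then show "- q (- x) \<le> q (x + t *\<^sub>R y) - t * q y"
      using sublinear_add[OF q, of "- x" "x + t *\<^sub>R y"] by (simp add: sublinear_scale[OF q])
  qed
  then show le: "r x \<le> q (x + t *\<^sub>R y) - t * q y" if "0 \<le> t" for x t
    unfolding r_def using that by (intro cINF_lower) auto
  show "sublinear r"
  proof (rule sublinearI)
    show "r 0 = 0" by (simp add: r_def sublinear_scale[OF q] cong: INF_cong_simp)
  next
    fix c :: real and x assume c: "0 < c"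
    have "r (c *\<^sub>R x) / c \<le> r x"
      unfolding r_eq[of x]
    proof (rule cINF_greatest)
      fix t :: real assume "t \<in> {0..}"
      then have "r (c *\<^sub>R x) \<le> q (c *\<^sub>R x + (c * t) *\<^sub>R y) - c * t * q y" using c by (intro le) simp
      also have "c *\<^sub>R x + (c * t) *\<^sub>R y = c *\<^sub>R (x + t *\<^sub>R y)" by (simp add: scaleR_right_distrib)
      also have "q \<dots> = c * q (x + t *\<^sub>R y)" using c by (simp add: sublinear_scale[OF q])
      finally show "r (c *\<^sub>R x) / c \<le> q (x + t *\<^sub>R y) - t * q y"
        using c by (simp add: field_simps)
    qed simp
    then show "r (c *\<^sub>R x) \<le> c * r x" using c by (simp add: field_simps)
  next
    fix x z
    have *: "r (x + z) \<le> (q (x + s *\<^sub>R y) - s * q y) + (q (z + t *\<^sub>R y) - t * q y)"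
      if "0 \<le> s" "0 \<le> t" for s t
    proof -
      have "r (x + z) \<le> q (x + z + (s + t) *\<^sub>R y) - (s + t) * q y" using that by (intro le) simp
      also have "x + z + (s + t) *\<^sub>R y = (x + s *\<^sub>R y) + (z + t *\<^sub>R y)"
        by (simp add: scaleR_left_distrib)
      finally show ?thesis
        using sublinear_add[OF q, of "x + s *\<^sub>R y" "z + t *\<^sub>R y"] by (simp add: algebra_simps)
    qed
    have "r (x + z) - (q (x + s *\<^sub>R y) - s * q y) \<le> r z" if "0 \<le> s" for s
      unfolding r_eq[of z] using *[OF that] by (intro cINF_greatest) (auto simp: algebra_simps)
    then have "r (x + z) - r z \<le> r x"
      unfolding r_eq[of x] by (intro cINF_greatest) (auto simp: algebra_simps)
    then show "r (x + z) \<le> r x + r z" by simp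
  qed
qed

lemma minimal_sublinear_linear:
  assumes q: "sublinear q" and min: "\<And>r. sublinear r \<Longrightarrow> r \<le> q \<Longrightarrow> r = q"
  shows "linear q"
proof -
  have add: "q (x + y) = q x + q y" for x y
  proof (rule antisym[OF sublinear_add[OF q]])
    let ?r = "\<lambda>x. INF t\<in>{0..}. q (x + t *\<^sub>R y) - t * q y"
    have "?r \<le> q" using sublinear_shift(2)[OF q, of 0] by (auto simp: le_fun_def)
    then have "?r = q" by (rule min[OF sublinear_shift(1)[OF q]])
    then show "q x + q y \<le> q (x + y)"
      using sublinear_shift(2)[OF q, of 1 x y] by (auto dest!: fun_cong[of _ _ x])
  qed
  have "q (- x) = - q x" for x using add[of x "- x"] sublinear_zero[OF q] by simp
  then have "q (c *\<^sub>R x) = c * q x" for c x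
    using sublinear_scale[OF q, of c x] sublinear_scale[OF q, of "- c" x] by (cases "0 \<le> c") auto
  then show ?thesis using add by (intro linearI) auto
qed

text \<open>Zorn's lemma for the reversed pointwise order, where a nonempty chain is bounded by its
  pointwise infimum.\<close>

lemma minimal_sublinear_exists:
  fixes p :: "'a :: real_vector \<Rightarrow> real"
  assumes p: "sublinear p"
  obtains q where "sublinear q" "q \<le> p" "\<And>r. sublinear r \<Longrightarrow> r \<le> q \<Longrightarrow> r = q"
proof -
  define A where "A = {q :: 'a \<Rightarrow> real. sublinear q \<and> q \<le> p}"
  have "\<exists>m\<in>A. \<forall>a\<in>A. m \<ge> a \<longrightarrow> a = m"
  proof (rule predicate_Zorn)
    show "partial_order_on A (relation_of (\<ge>) A)"
      by (rule partial_order_on_relation_ofI) auto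
    fix C assume "C \<in> Chains (relation_of (\<ge>) A)"
    then have C: "C \<subseteq> A" "\<forall>q\<in>C. \<forall>r\<in>C. q \<le> r \<or> r \<le> q"
      by (auto simp: Chains_def relation_of_def)
    show "\<exists>u\<in>A. \<forall>a\<in>C. a \<ge> u"
    proof (cases "C = {}")
      case True
      then show ?thesis using p by (auto simp: A_def)
    next
      case False
      have sub: "\<forall>q\<in>C. sublinear q" using C by (auto simp: A_def)
      note inf = sublinear_chain_inf[OF sub False C(2)]
      obtain q0 where q0: "q0 \<in> C" using False by blast
      then have "q0 \<le> p" using C by (auto simp: A_def)
      then have "(\<lambda>x. INF q\<in>C. q x) \<le> p"
        using inf(2)[OF q0] by (auto simp: le_fun_def intro: order_trans)
      then have "(\<lambda>x. INF q\<in>C. q x) \<in> A" using inf(1) by (simp add: A_def)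
      moreover have "\<forall>a\<in>C. (\<lambda>x. INF q\<in>C. q x) \<le> a" using inf(2) by (auto simp: le_fun_def)
      ultimately show ?thesis by blast
    qed
  qed
  then obtain q where q: "q \<in> A" "\<And>r. r \<in> A \<Longrightarrow> r \<le> q \<Longrightarrow> r = q" by auto
  show ?thesis
  proof (rule that[of q])
    show "r = q" if "sublinear r" "r \<le> q" for r
      using q that by (auto simp: A_def intro: order_trans)
  qed (use q in \<open>auto simp: A_def\<close>)
qed

text \<open>A minimal functional is taken below the shift \<open>?r\<close> rather than below
  \<open>p\<close> itself: \<open>t = 0\<close> gives \<open>q x \<le> p x\<close>, and
  \<open>t = 1\<close> at \<open>- y\<close> gives \<open>q (- y) \<le> - p y\<close>, which forces
  equality at \<open>y\<close>.\<close>

theorem hahn_banach_sublinear: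
  fixes p :: "'a :: real_vector \<Rightarrow> real"
  assumes p: "sublinear p"
  obtains g where "linear g" "\<And>x. g x \<le> p x" "g y = p y"
proof -
  let ?r = "\<lambda>x. INF t\<in>{0..}. p (x + t *\<^sub>R y) - t * p y"
  note r = sublinear_shift[OF p, where y = y]
  obtain q where q: "sublinear q" "q \<le> ?r" "\<And>r. sublinear r \<Longrightarrow> r \<le> q \<Longrightarrow> r = q"
    using minimal_sublinear_exists[OF r(1)] by blast
  have lin: "linear q" by (rule minimal_sublinear_linear[OF q(1,3)])
  have le: "q x \<le> p x" for x
    using le_funD[OF q(2), of x] r(2)[of 0 x] by simp
  have "q (- y) \<le> - p y"
    using le_funD[OF q(2), of "- y"] r(2)[of 1 "- y"] sublinear_zero[OF p] by simp
  then have "q y = p y" using le[of y] linear_neg[OF lin, of y] by simp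
  then show ?thesis using that lin le by blast
qed

text \<open>The one-sided derivative of the norm at \<open>1\<close> in direction \<open>x\<close>: the infimum, with \<open>s = 1 / t\<close>, of
  the difference quotients \<open>(norm (1 + t x) - 1) / t\<close>. A real functional dominated by it is the real
  part of a state.\<close>

definition one_slope :: "'a :: real_normed_algebra_1 \<Rightarrow> real" where
  "one_slope x = (INF s\<in>{0..}. norm (s *\<^sub>R 1 + x) - s)"

lemma one_slope_le: "0 \<le> s \<Longrightarrow> one_slope x \<le> norm (s *\<^sub>R 1 + x) - s"
  for x :: "'a :: real_normed_algebra_1"
  unfolding one_slope_def
proof (rule cINF_lower)
  show "bdd_below ((\<lambda>s. norm (s *\<^sub>R 1 + x) - s) ` {0..})"
  proof (rule bdd_belowI2)
    fix s :: real assume "s \<in> {0..}"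
    then show "- norm x \<le> norm (s *\<^sub>R 1 + x) - s"
      using norm_diff_ineq[of "s *\<^sub>R 1" x] by simp
  qed
qed simp

lemma one_slope_greatest:
  fixes x :: "'a :: real_normed_algebra_1"
  assumes "\<And>s. 0 \<le> s \<Longrightarrow> c \<le> norm (s *\<^sub>R 1 + x) - s"
  shows "c \<le> one_slope x"
  unfolding one_slope_def using assms by (intro cINF_greatest) auto

lemma sublinear_one_slope: "sublinear (one_slope :: 'a :: real_normed_algebra_1 \<Rightarrow> real)"
proof (rule sublinearI)
  show "one_slope (0::'a) = 0" by (simp add: one_slope_def cong: INF_cong_simp)
next
  fix c :: real and x :: 'a assume c: "0 < c"
  have "one_slope (c *\<^sub>R x) / c \<le> one_slope x"
  proof (rule one_slope_greatest)
    fix s :: real assume "0 \<le> s"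
    then have "one_slope (c *\<^sub>R x) \<le> norm ((c * s) *\<^sub>R 1 + c *\<^sub>R x) - c * s"
      using c by (intro one_slope_le) simp
    also have "(c * s) *\<^sub>R 1 + c *\<^sub>R x = c *\<^sub>R (s *\<^sub>R 1 + x)" by (simp add: scaleR_right_distrib)
    also have "norm \<dots> = c * norm (s *\<^sub>R 1 + x)" using c by simp
    finally show "one_slope (c *\<^sub>R x) / c \<le> norm (s *\<^sub>R 1 + x) - s"
      using c by (simp add: field_simps)
  qed
  then show "one_slope (c *\<^sub>R x) \<le> c * one_slope x" using c by (simp add: field_simps)
next
  fix x y :: 'a
  have *: "one_slope (x + y) \<le> (norm (s *\<^sub>R 1 + x) - s) + (norm (t *\<^sub>R 1 + y) - t)"
    if "0 \<le> s" "0 \<le> t" for s t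
  proof -
    have "one_slope (x + y) \<le> norm ((s + t) *\<^sub>R 1 + (x + y)) - (s + t)"
      using that by (intro one_slope_le) simp
    also have "(s + t) *\<^sub>R 1 + (x + y) = (s *\<^sub>R 1 + x) + (t *\<^sub>R 1 + y)"
      by (simp add: scaleR_left_distrib)
    finally show ?thesis
      using norm_triangle_ineq[of "s *\<^sub>R 1 + x" "t *\<^sub>R 1 + y"] by linarith
  qed
  have "one_slope (x + y) - (norm (s *\<^sub>R 1 + x) - s) \<le> one_slope y" if "0 \<le> s" for s
    using *[OF that] by (intro one_slope_greatest) (simp add: algebra_simps)
  then have "one_slope (x + y) - one_slope y \<le> one_slope x"
    by (intro one_slope_greatest) (simp add: algebra_simps)
  then show "one_slope (x + y) \<le> one_slope x + one_slope y" by simp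
qed

section \<open>States and the metric meaning of real positivity\<close>

lemma scaleC_one [simp]: "1 *\<^sub>C x = (x :: 'a :: complex_banach_algebra_1)"
  using scaleR_scaleC[of 1 x] by simp

lemma scaleC_minus_left: "(- c) *\<^sub>C x = - (c *\<^sub>C x)" for x :: "'a :: complex_banach_algebra_1"
proof -
  have "0 *\<^sub>C x = 0" using scaleR_scaleC[of 0 x] by simp
  then have "c *\<^sub>C x + (- c) *\<^sub>C x = 0" using scaleC_add_left[of c "- c" x] by simp
  then show ?thesis by (simp add: add_eq_0_iff)
qed

text \<open>A complex linear functional is recovered from its real part \<open>g\<close> as
  \<open>g x - \<i> * g (\<i> x)\<close>; rotating the argument turns the bound on \<open>g\<close>
  into one on the modulus.\<close>

lemma state_of_real_functional:
  fixes g :: "'a :: complex_banach_algebra_1 \<Rightarrow> real"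
  assumes lin: "linear g" and le: "\<And>x. g x \<le> norm x" and one: "g 1 = 1"
  obtains \<omega> where "state \<omega>" "\<And>x. Re (\<omega> x) = g x"
proof -
  define \<omega> where "\<omega> x = Complex (g x) (- g (\<i> *\<^sub>C x))" for x
  have add: "\<omega> (x + y) = \<omega> x + \<omega> y" for x y
    by (simp add: \<omega>_def linear_add[OF lin] scaleC_add_right complex_eq_iff)
  have real: "\<omega> (r *\<^sub>R x) = r *\<^sub>R \<omega> x" for r x
  proof -
    have "\<i> *\<^sub>C (r *\<^sub>R x) = r *\<^sub>R (\<i> *\<^sub>C x)" by (simp add: scaleR_scaleC scaleC_scaleC mult.commute)
    then show ?thesis by (simp add: \<omega>_def linear_scale[OF lin] complex_eq_iff)
  qed
  have imag: "\<omega> (\<i> *\<^sub>C x) = \<i> * \<omega> x" for x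
    by (simp add: \<omega>_def scaleC_scaleC scaleC_minus_left linear_neg[OF lin] complex_eq_iff)
  have scale: "\<omega> (c *\<^sub>C x) = c * \<omega> x" for c x
  proof -
    have "c *\<^sub>C x = Re c *\<^sub>R x + \<i> *\<^sub>C (Im c *\<^sub>R x)"
      unfolding scaleR_scaleC scaleC_scaleC scaleC_add_left[symmetric] by (metis complex_eq)
    then have "\<omega> (c *\<^sub>C x) = Re c *\<^sub>R \<omega> x + \<i> * (Im c *\<^sub>R \<omega> x)"
      by (simp only: add imag real)
    then show ?thesis by (simp add: complex_eq_iff)
  qed
  have bound: "cmod (\<omega> x) \<le> norm x" for x
  proof (cases "\<omega> x = 0")
    case False
    \<comment> \<open>\<open>u\<close> rotates \<open>\<omega> x\<close> onto the positive real
      axis, where the modulus is a value of \<open>g\<close>.\<close>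
    define u where "u = cnj (\<omega> x) / of_real (cmod (\<omega> x))"
    have u: "cmod u = 1" using False by (simp add: u_def norm_divide)
    have "cnj (\<omega> x) * \<omega> x = of_real (cmod (\<omega> x)) * of_real (cmod (\<omega> x))"
      using complex_norm_square[of "\<omega> x"] by (simp add: power2_eq_square mult.commute)
    then have "u * \<omega> x = of_real (cmod (\<omega> x))" using False by (simp add: u_def)
    then have "cmod (\<omega> x) = Re (\<omega> (u *\<^sub>C x))" by (simp add: scale)
    also have "\<dots> = g (u *\<^sub>C x)" by (simp add: \<omega>_def)
    also have "\<dots> \<le> norm x" using le[of "u *\<^sub>C x"] u by (simp add: norm_scaleC)
    finally show ?thesis .
  qed simp
  have bl: "bounded_linear \<omega>"
    using bound by (intro bounded_linear_intro[of _ 1]) (auto simp: add real)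
  have Re1: "Re (\<omega> 1) = 1" by (simp add: \<omega>_def one)
  \<comment> \<open>A point of the closed unit disc with real part \<open>1\<close> has imaginary
    part \<open>0\<close>.\<close>
  have "(Re (\<omega> 1))\<^sup>2 + (Im (\<omega> 1))\<^sup>2 \<le> 1"
    using bound[of 1] power_mono[of "cmod (\<omega> 1)" 1 2] by (simp add: cmod_power2)
  then have one': "\<omega> 1 = 1" using Re1 by (simp add: complex_eq_iff)
  have "onorm \<omega> \<le> 1" using bound by (intro onorm_bound) auto
  moreover have "1 \<le> onorm \<omega>" using onorm[OF bl, of 1] one' by simp
  ultimately have "state \<omega>" using bl scale one' by (simp add: state_def)
  then show ?thesis using that by (simp add: \<omega>_def)
qed

text \<open>Applied to a real positive \<open>x\<close>, this yields the metric condition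
  \<open>one_slope (- x) \<le> 0\<close>. A functional below \<open>one_slope\<close> is below the
  norm by \<open>s = 0\<close>, and \<open>s = 1\<close> in direction \<open>- 1\<close> gives
  \<open>1 \<le> g 1\<close>.\<close>

lemma state_minus_slope:
  fixes x :: "'a :: complex_banach_algebra_1"
  obtains \<omega> where "state \<omega>" "Re (\<omega> x) = - one_slope (- x)"
proof -
  obtain g where g: "linear g" "\<And>y. g y \<le> one_slope y" "g (- x) = one_slope (- x)"
    using hahn_banach_sublinear[OF sublinear_one_slope] by blast
  have "g y \<le> norm y" for y using g(2)[of y] one_slope_le[of 0 y] by simp
  moreover have "g 1 = 1"
  proof (rule antisym)
    show "g 1 \<le> 1" using calculation[of 1] by simp
    have "g (- 1) \<le> - 1" using g(2)[of "- 1"] one_slope_le[of 1 "- 1 :: 'a"] by simp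
    then show "1 \<le> g 1" by (simp add: linear_neg[OF g(1)])
  qed
  ultimately obtain \<omega> where "state \<omega>" "\<And>x. Re (\<omega> x) = g x"
    using state_of_real_functional g(1) by blast
  then show ?thesis using that g(3) by (simp add: linear_neg[OF g(1)])
qed

text \<open>Follows from \<open>(s + l) y = (l + e) y + (s - e) y\<close>, choosing \<open>s\<close> such that \<open>norm (s - e)\<close>
  barely exceeds \<open>s\<close>.\<close>

lemma real_positive_norm_ge:
  fixes e y :: "'a :: complex_banach_algebra_1"
  assumes e: "real_positive e" and l: "0 \<le> l"
  shows "l * norm y \<le> norm ((l *\<^sub>R 1 + e) * y)"
proof -
  obtain \<omega> where "state \<omega>" "Re (\<omega> e) = - one_slope (- e)"
    using state_minus_slope .
  then have slope: "one_slope (- e) \<le> 0" using e by (auto simp: real_positive_def)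
  have "l * norm y - norm ((l *\<^sub>R 1 + e) * y) \<le> d * norm y" if d: "0 < d" for d
  proof -
    have "\<exists>s\<ge>0. norm (s *\<^sub>R 1 - e) - s < d"
    proof (rule ccontr)
      assume "\<not> ?thesis"
      then have "d \<le> one_slope (- e)" by (intro one_slope_greatest) force
      then show False using slope d by simp
    qed
    then obtain s where s: "0 \<le> s" "norm (s *\<^sub>R 1 - e) \<le> s + d" by auto
    have "(s + l) *\<^sub>R y = (l *\<^sub>R 1 + e) * y + (s *\<^sub>R 1 - e) * y"
      by (simp add: algebra_simps)
    then have "norm ((s + l) *\<^sub>R y) \<le> norm ((l *\<^sub>R 1 + e) * y) + norm ((s *\<^sub>R 1 - e) * y)"
      using norm_triangle_ineq by metis
    also have "norm ((s *\<^sub>R 1 - e) * y) \<le> (s + d) * norm y"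
      using s by (intro order_trans[OF norm_mult_ineq] mult_right_mono) auto
    also have "norm ((s + l) *\<^sub>R y) = (s + l) * norm y" using s l by simp
    finally show ?thesis by (simp add: algebra_simps)
  qed
  then have "l * norm y - norm ((l *\<^sub>R 1 + e) * y) \<le> 0"
    by (intro tendsto_lowerbound[where f = "\<lambda>d. d * norm y" and F = "at_right 0"])
      (auto intro!: tendsto_eq_intros simp: eventually_at_right_less intro: eventually_mono[OF eventually_at_right_less])
  then show ?thesis by simp
qed

text \<open>The element \<open>(1 - e) + (l / (1 + l)) *\<^sub>R e\<close> is \<open>l\<close> times
  the inverse of \<open>l *\<^sub>R 1 + e\<close>, so the lower bound in
  \<open>real_positive_norm_ge\<close> makes it a contraction. As \<open>l\<close> tends to
  \<open>0\<close> it tends to \<open>1 - e\<close>.\<close>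

lemma norm_one_minus_idempotent_le:
  fixes e :: "'a :: complex_banach_algebra_1"
  assumes "idempotent e" "real_positive e"
  shows "norm (1 - e) \<le> 1"
proof -
  have ee: "e * e = e" using assms(1) by (simp add: idempotent_def)
  have "norm ((1 - e) + (l / (1 + l)) *\<^sub>R e) \<le> 1" if l: "0 < l" for l :: real
  proof -
    define c where "c = l / (1 + l)"
    have "(l + 1) * c = l" using l by (simp add: c_def add.commute)
    then have c: "l * c + c = l" by (simp add: distrib_right)
    have "(l *\<^sub>R 1 + e) * ((1 - e) + c *\<^sub>R e) = l *\<^sub>R (1 - e) + (l * c + c) *\<^sub>R e"
      by (simp add: algebra_simps ee)
    also have "\<dots> = l *\<^sub>R 1" unfolding c by (simp add: algebra_simps)
    finally have "l * norm ((1 - e) + c *\<^sub>R e) \<le> l"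
      using real_positive_norm_ge[OF assms(2), of l "(1 - e) + c *\<^sub>R e"] l by simp
    then show ?thesis using l by (simp add: c_def)
  qed
  then have "eventually (\<lambda>l. norm ((1 - e) + (l / (1 + l)) *\<^sub>R e) \<le> 1) (at_right (0::real))"
    by (intro eventually_mono[OF eventually_at_right_less]) auto
  moreover have "((\<lambda>l::real. norm ((1 - e) + (l / (1 + l)) *\<^sub>R e)) \<longlongrightarrow> norm ((1 - e) + (0 / (1 + 0)) *\<^sub>R e)) (at_right 0)"
    by (intro tendsto_intros) auto
  ultimately show ?thesis by (intro tendsto_upperbound[of _ "norm (1 - e)" "at_right (0::real)"]) auto
qed

lemma state_bound: "state \<phi> \<Longrightarrow> cmod (\<phi> x) \<le> norm x"
  using onorm[of \<phi> x] by (simp add: state_def)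

lemma state_Re_le_zero:
  fixes \<phi> :: "'a :: complex_banach_algebra_1 \<Rightarrow> complex"
  assumes \<phi>: "state \<phi>" and f: "\<phi> f = 1"
    and small: "\<And>\<eta>. 0 < \<eta> \<Longrightarrow> \<exists>t>0. norm (f + t *\<^sub>R b) \<le> 1 + \<eta> * t"
  shows "Re (\<phi> b) \<le> 0"
proof (rule field_le_epsilon)
  fix \<eta> :: real assume "0 < \<eta>"
  then obtain t where t: "0 < t" "norm (f + t *\<^sub>R b) \<le> 1 + \<eta> * t" using small by blast
  interpret bounded_linear \<phi> using \<phi> by (simp add: state_def)
  have "1 + t * Re (\<phi> b) = Re (\<phi> (f + t *\<^sub>R b))" by (simp add: add scaleR f)
  also have "\<dots> \<le> cmod (\<phi> (f + t *\<^sub>R b))" by (rule complex_Re_le_cmod)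
  also have "\<dots> \<le> 1 + \<eta> * t" using state_bound[OF \<phi>] t(2) by (rule order_trans)
  finally show "Re (\<phi> b) \<le> 0 + \<eta>" using t(1) by (simp add: mult.commute)
qed

section \<open>Operators on \<open>L\<^sup>p\<close>\<close>

text \<open>The root is omitted so that pointwise inequalities between \<open>p\<close>-th powers
  integrate to inequalities between these values.\<close>

definition Lp_power :: "real \<Rightarrow> 'x measure \<Rightarrow> ('x \<Rightarrow> complex) set \<Rightarrow> real" where
  "Lp_power p M F = (LINT x|M. cmod (Lp_rep F x) powr p)"

lemma Lp_class_in_space: "f \<in> Lp_fun p M \<Longrightarrow> Lp_class p M f \<in> Lp_space p M"
  by (simp add: Lp_space_def Lp_class_def quotientI)

lemma Lp_spaceE:
  assumes "F \<in> Lp_space p M"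
  obtains f where "f \<in> Lp_fun p M" "F = Lp_class p M f"
  using assms by (auto simp: Lp_space_def Lp_class_def elim!: quotientE)

lemma Lp_power_class:
  assumes "f \<in> Lp_fun p M"
  shows "Lp_power p M (Lp_class p M f) = (LINT x|M. cmod (f x) powr p)"
  unfolding Lp_power_def
  using Lp_rel_rep[OF assms] by (intro integral_cong_AE) (auto simp: Lp_rel_def Lp_fun_def)

lemma Lp_power_nonneg: "0 \<le> Lp_power p M F"
  by (simp add: Lp_power_def)

lemma Lp_norm_eq_Lp_power: "Lp_norm p M F = Lp_power p M F powr (1 / p)"
  by (simp add: Lp_norm_def Lp_power_def)

lemma Lp_norm_nonneg: "0 \<le> Lp_norm p M F"
  by (simp add: Lp_norm_def)

lemma Lp_power_eq_Lp_norm: "1 < p \<Longrightarrow> Lp_power p M F = Lp_norm p M F powr p"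
  by (simp add: Lp_norm_eq_Lp_power powr_powr Lp_power_nonneg)

lemma Lp_scale_in_space:
  assumes "F \<in> Lp_space p M"
  shows "Lp_scale p M c F \<in> Lp_space p M"
  using assms by (elim Lp_spaceE) (simp add: Lp_scale_class Lp_class_in_space Lp_fun_scale)

lemma Lp_norm_scale:
  assumes p: "1 < p" and F: "F \<in> Lp_space p M"
  shows "Lp_norm p M (Lp_scale p M c F) = cmod c * Lp_norm p M F"
proof -
  obtain f where f: "f \<in> Lp_fun p M" "F = Lp_class p M f" using F by (rule Lp_spaceE)
  show ?thesis
    using p by (simp add: f Lp_scale_class Lp_fun_scale Lp_norm_class norm_mult powr_mult powr_powr)
qed

lemma Lp_zero_in_space: "1 < p \<Longrightarrow> Lp_zero p M \<in> Lp_space p M"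
  by (simp add: Lp_zero_def Lp_class_in_space Lp_fun_def)

lemma Lp_norm_zero: "1 < p \<Longrightarrow> Lp_norm p M (Lp_zero p M) = 0"
  by (simp add: Lp_zero_def Lp_norm_class Lp_fun_def)

text \<open>The claim follows by homogeneity after normalising \<open>F\<close>. A class of norm
  \<open>0\<close> cannot be normalised and is handled by the bound \<open>K\<close>, which also
  makes the supremum a genuine one.\<close>

lemma Lp_op_norm_upper:
  assumes p: "1 < p" and T: "T \<in> Lp_operators p M" and F: "F \<in> Lp_space p M"
  shows "Lp_norm p M (T F) \<le> Lp_op_norm p M T * Lp_norm p M F"
proof -
  obtain K where K: "\<And>F. F \<in> Lp_space p M \<Longrightarrow> Lp_norm p M (T F) \<le> K * Lp_norm p M F"
    using T unfolding Lp_operators_def by blast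
  have TF: "T F \<in> Lp_space p M" using T F by (auto simp: Lp_operators_def)
  show ?thesis
  proof (cases "Lp_norm p M F = 0")
    case True
    then show ?thesis using K[OF F] by simp
  next
    case False
    then have pos: "0 < Lp_norm p M F" using Lp_norm_nonneg[of p M F] by simp
    let ?c = "of_real (inverse (Lp_norm p M F)) :: complex"
    let ?G = "Lp_scale p M ?c F"
    have G: "?G \<in> Lp_space p M" "Lp_norm p M ?G \<le> 1"
      using pos F p by (auto simp: Lp_scale_in_space Lp_norm_scale norm_inverse)
    have "Lp_norm p M (T ?G) \<le> Lp_op_norm p M T"
      unfolding Lp_op_norm_def
    proof (rule cSUP_upper)
      show "bdd_above ((\<lambda>F. Lp_norm p M (T F)) ` {F \<in> Lp_space p M. Lp_norm p M F \<le> 1})"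
      proof (rule bdd_aboveI2)
        fix F assume "F \<in> {F \<in> Lp_space p M. Lp_norm p M F \<le> 1}"
        then have "Lp_norm p M (T F) \<le> K * Lp_norm p M F" "Lp_norm p M F \<le> 1" using K by auto
        moreover have "K * Lp_norm p M F \<le> \<bar>K\<bar> * 1"
          using calculation Lp_norm_nonneg[of p M F] by (intro mult_mono) auto
        ultimately show "Lp_norm p M (T F) \<le> \<bar>K\<bar>" by simp
      qed
    qed (use G in simp)
    moreover have "T ?G = Lp_scale p M ?c (T F)" using T F by (auto simp: Lp_operators_def)
    ultimately have "inverse (Lp_norm p M F) * Lp_norm p M (T F) \<le> Lp_op_norm p M T"
      using pos p TF by (simp add: Lp_norm_scale norm_inverse)
    then show ?thesis using pos by (simp add: field_simps)
  qed
qed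

lemma Lp_op_norm_least:
  assumes p: "1 < p"
    and "\<And>F. F \<in> Lp_space p M \<Longrightarrow> Lp_norm p M F \<le> 1 \<Longrightarrow> Lp_norm p M (T F) \<le> c"
  shows "Lp_op_norm p M T \<le> c"
proof -
  have "{F \<in> Lp_space p M. Lp_norm p M F \<le> 1} \<noteq> {}"
    using Lp_zero_in_space[OF p, of M] Lp_norm_zero[OF p, of M] by force
  then show ?thesis unfolding Lp_op_norm_def using assms(2) by (intro cSUP_least) auto
qed

text \<open>For fixed representatives every term is integrable, so the sum is the integral of a
  pointwise nonnegative function.\<close>

lemma Lp_power_combination_nonneg:
  fixes ts :: "(real \<times> real \<times> real) list"
  assumes p: "1 < p" and F: "F \<in> Lp_space p M" and G: "G \<in> Lp_space p M"
    and nonneg: "\<And>z w. 0 \<le> (\<Sum>(\<alpha>, c, d)\<leftarrow>ts. \<alpha> * cmod (of_real c * z + of_real d * w) powr p)"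
  shows "0 \<le> (\<Sum>(\<alpha>, c, d)\<leftarrow>ts.
    \<alpha> * Lp_power p M (Lp_add p M (Lp_scale p M (of_real c) F) (Lp_scale p M (of_real d) G)))"
proof -
  obtain f g where f: "f \<in> Lp_fun p M" "F = Lp_class p M f"
    and g: "g \<in> Lp_fun p M" "G = Lp_class p M g"
    using F G by (metis Lp_spaceE)
  have mem: "(\<lambda>x. of_real c * f x + of_real d * g x) \<in> Lp_fun p M" for c d
    using p f g by (intro Lp_fun_add Lp_fun_scale) auto
  then have int: "integrable M (\<lambda>x. cmod (of_real c * f x + of_real d * g x) powr p)" for c d
    by (simp add: Lp_fun_def)
  have power: "Lp_power p M (Lp_add p M (Lp_scale p M (of_real c) F) (Lp_scale p M (of_real d) G))
      = (LINT x|M. cmod (of_real c * f x + of_real d * g x) powr p)" for c d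
    using p f g mem by (simp add: Lp_scale_class Lp_add_class Lp_fun_scale Lp_power_class)
  have int_sum: "integrable M (\<lambda>x. \<Sum>(\<alpha>, c, d)\<leftarrow>us. \<alpha> * cmod (of_real c * f x + of_real d * g x) powr p)" for us
    by (induction us) (auto intro!: Bochner_Integration.integrable_add integrable_mult_right int)
  have "(\<Sum>(\<alpha>, c, d)\<leftarrow>us. \<alpha> * (LINT x|M. cmod (of_real c * f x + of_real d * g x) powr p))
      = (LINT x|M. (\<Sum>(\<alpha>, c, d)\<leftarrow>us. \<alpha> * cmod (of_real c * f x + of_real d * g x) powr p))" for us
  proof (induction us)
    case (Cons u us)
    obtain \<alpha> c d where "u = (\<alpha>, c, d)" by (cases u)
    then show ?case
      using Cons int[of c d] int_sum[of us] by simp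
  qed simp
  then show ?thesis by (simp add: power nonneg)
qed

text \<open>Abstracts the functionals \<open>b \<mapsto> norm (b F)\<^sup>p\<close> for \<open>F\<close> in the unit ball of \<open>L\<^sup>p\<close>. The last clause says
  that pointwise linear inequalities between terms \<open>\<bar>c z + d w\<bar>\<^sup>p\<close> can be integrated; each list entry
  \<open>(\<alpha>, c, d)\<close> stands for one such term with coefficient \<open>\<alpha>\<close>.\<close>

definition Lp_modular :: "real \<Rightarrow> ('a :: real_normed_algebra_1 \<Rightarrow> real) \<Rightarrow> bool" where
  "Lp_modular p I \<longleftrightarrow> (\<forall>b. I b \<le> norm b powr p) \<and> (\<forall>a b. I (a * b) \<le> norm a powr p * I b) \<and>
    (\<forall>ts a b. (\<forall>z w. 0 \<le> (\<Sum>(\<alpha>, c, d)\<leftarrow>ts. \<alpha> * cmod (of_real c * z + of_real d * w) powr p)) \<longrightarrow>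
       0 \<le> (\<Sum>(\<alpha>, c, d)\<leftarrow>ts. \<alpha> * I (c *\<^sub>R a + d *\<^sub>R b)))"

text \<open>The second property is the operator norm as a supremum over the unit ball, in
  \<open>p\<close>-th powers. As \<open>\<pi> 1\<close> may differ from the identity operator, later
  estimates use \<open>I 1 \<le> 1\<close> in place of the norm of the underlying class.\<close>

lemma Lp_operator_algebra_modulars:
  assumes p: "1 < p" and "Lp_operator_algebra p TYPE('x) TYPE('a :: complex_banach_algebra_1)"
  obtains \<I> :: "('a :: complex_banach_algebra_1 \<Rightarrow> real) set" where "\<And>I. I \<in> \<I> \<Longrightarrow> Lp_modular p I"
    "\<And>b c. 0 \<le> c \<Longrightarrow> (\<And>I. I \<in> \<I> \<Longrightarrow> I b \<le> c powr p) \<Longrightarrow> norm b \<le> c"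
proof -
  obtain M :: "'x measure" and B and \<pi> :: "'a \<Rightarrow> _"
    where B: "Lp_closed_subalgebra p M B" and \<pi>: "Lp_isometric_isomorphism p M B \<pi>"
    using assms(2) by (auto simp: Lp_operator_algebra_def)
  have op: "\<pi> a \<in> Lp_operators p M" for a
    using B \<pi> by (auto simp: Lp_closed_subalgebra_def Lp_isometric_isomorphism_def bij_betw_def)
  have space: "\<pi> a F \<in> Lp_space p M" if "F \<in> Lp_space p M" for a F
    using op[of a] that unfolding Lp_operators_def by (blast dest: PiE_mem)
  have norm: "Lp_op_norm p M (\<pi> a) = norm a" for a
    using \<pi> by (simp add: Lp_isometric_isomorphism_def)
  have mult: "\<pi> (a * b) F = \<pi> a (\<pi> b F)" if "F \<in> Lp_space p M" for a b F
    using \<pi> that by (simp add: Lp_isometric_isomorphism_def Lp_op_mult_def compose_def)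
  have comb: "\<pi> (c *\<^sub>R a + d *\<^sub>R b) F
      = Lp_add p M (Lp_scale p M (of_real c) (\<pi> a F)) (Lp_scale p M (of_real d) (\<pi> b F))"
    if "F \<in> Lp_space p M" for a b c d F
    using \<pi> that
    by (simp add: Lp_isometric_isomorphism_def Lp_op_add_def Lp_op_scale_def scaleR_scaleC)
  have bound: "Lp_power p M (\<pi> a F) \<le> norm a powr p * Lp_power p M F"
    if "F \<in> Lp_space p M" for a F
  proof -
    have "Lp_norm p M (\<pi> a F) powr p \<le> (norm a * Lp_norm p M F) powr p"
      using Lp_op_norm_upper[OF p op that, of a] p
      by (intro powr_mono2) (auto simp: norm Lp_norm_nonneg)
    then show ?thesis using p by (simp add: Lp_power_eq_Lp_norm powr_mult Lp_norm_nonneg)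
  qed
  define \<I> where "\<I> = {\<lambda>a. Lp_power p M (\<pi> a F) | F. F \<in> Lp_space p M \<and> Lp_norm p M F \<le> 1}"
  show ?thesis
  proof (rule that[of \<I>])
    fix I assume "I \<in> \<I>"
    then obtain F where I: "I = (\<lambda>a. Lp_power p M (\<pi> a F))"
      and F: "F \<in> Lp_space p M" "Lp_norm p M F \<le> 1" by (auto simp: \<I>_def)
    have "Lp_power p M F \<le> 1"
      using p F(2) Lp_norm_nonneg[of p M F] by (auto simp: Lp_power_eq_Lp_norm intro: powr_le1)
    then have "I a \<le> norm a powr p" for a
      using bound[OF F(1), of a] mult_left_mono[of "Lp_power p M F" 1 "norm a powr p"] by (simp add: I)
    then show "Lp_modular p I"
      unfolding Lp_modular_def using F(1)
      by (auto simp: I mult comb bound space intro!: Lp_power_combination_nonneg[OF p])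
  next
    fix b c assume c: "0 \<le> c" and le: "\<And>I. I \<in> \<I> \<Longrightarrow> I b \<le> c powr p"
    have "Lp_op_norm p M (\<pi> b) \<le> c"
    proof (rule Lp_op_norm_least[OF p])
      fix F assume "F \<in> Lp_space p M" "Lp_norm p M F \<le> 1"
      then have "Lp_norm p M (\<pi> b F) powr p \<le> c powr p"
        using le[of "\<lambda>a. Lp_power p M (\<pi> a F)"] p by (auto simp: \<I>_def Lp_power_eq_Lp_norm)
      then show "Lp_norm p M (\<pi> b F) \<le> c"
        using p c powr_less_mono2[of p c "Lp_norm p M (\<pi> b F)"] by (auto simp: not_le[symmetric])
    qed
    then show "norm b \<le> c" by (simp add: norm)
  qed
qed

section \<open>Perturbations of the complementary idempotent\<close>

lemma Lp_modular_bound: "Lp_modular p I \<Longrightarrow> I b \<le> norm b powr p"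
  and Lp_modular_mult: "Lp_modular p I \<Longrightarrow> I (a * b) \<le> norm a powr p * I b"
  by (auto simp: Lp_modular_def)

lemma Lp_modular_combination:
  assumes "Lp_modular p I"
    and "\<And>z w. 0 \<le> (\<Sum>(\<alpha>, c, d)\<leftarrow>ts. \<alpha> * cmod (of_real c * z + of_real d * w) powr p)"
  shows "0 \<le> (\<Sum>(\<alpha>, c, d)\<leftarrow>ts. \<alpha> * I (c *\<^sub>R a + d *\<^sub>R b))"
  using assms by (auto simp: Lp_modular_def)

lemma Lp_modular_nonneg: "Lp_modular p I \<Longrightarrow> 0 \<le> I b"
  using Lp_modular_combination[of p I "[(1, 1, 0)]" b 0] by simp

lemma Lp_modular_contraction:
  assumes "1 < p" "Lp_modular p I" "norm a \<le> 1"
  shows "I (a * b) \<le> I b"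
proof -
  have "norm a powr p \<le> 1" using assms by (intro powr_le1) auto
  then have "norm a powr p * I b \<le> 1 * I b"
    using Lp_modular_nonneg[OF assms(2)] by (intro mult_right_mono) auto
  then show ?thesis using Lp_modular_mult[OF assms(2), of a b] by simp
qed

text \<open>Since \<open>f\<close> fixes itself, it maps the midpoint of \<open>1\<close> and
  \<open>f\<close> to \<open>f\<close>, so the midpoint is at least as large as \<open>f\<close>.
  Uniform convexity then bounds \<open>I e\<close> by a small constant plus a multiple of
  \<open>1 - I f\<close>, and this defect absorbs the perturbation with one \<open>t\<close> for all
  \<open>I\<close>.\<close>

lemma exists_norm_add_left_le:
  fixes f e a :: "'a :: real_normed_algebra_1" and \<I> :: "('a \<Rightarrow> real) set"
  assumes p: "1 < p" and I: "\<And>I. I \<in> \<I> \<Longrightarrow> Lp_modular p I"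
    and norm: "\<And>b c. 0 \<le> c \<Longrightarrow> (\<And>I. I \<in> \<I> \<Longrightarrow> I b \<le> c powr p) \<Longrightarrow> norm b \<le> c"
    and f: "f * f = f" "norm f \<le> 1" and e: "e = 1 - f" and \<eta>: "0 < \<eta>"
  shows "\<exists>t>0. norm (f + t *\<^sub>R (a * e)) \<le> 1 + \<eta> * t"
proof -
  define A where "A = norm a powr p + 1"
  define N where "N = \<eta> powr (1 - p)"
  \<comment> \<open>Chosen so that \<open>N * A * (2 * \<epsilon>) = \<eta>\<close>.\<close>
  define \<epsilon> where "\<epsilon> = \<eta> / (2 * (N * A))"
  have A: "0 < A" "norm a powr p \<le> A" and N: "0 < N"
    using \<eta> by (auto simp: A_def N_def add_nonneg_pos)
  then have \<epsilon>: "0 < \<epsilon>" using \<eta> by (simp add: \<epsilon>_def)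
  obtain C where C: "0 < C" "\<And>z w :: complex. cmod (z - w) powr p \<le> \<epsilon> * (cmod z powr p + cmod w powr p)
       + C * ((cmod z powr p + cmod w powr p) / 2 - cmod ((z + w) / 2) powr p)"
    using cmod_powr_uniformly_convex[OF p \<epsilon>] by blast
  \<comment> \<open>This gives \<open>N * t * A * (C / 2) = 1\<close>, so the defect
    \<open>1 - I f\<close> enters with coefficient one and cancels against \<open>I f\<close> in
    \<open>main\<close>.\<close>
  define t where "t = 2 / (N * A * C)"
  have t: "0 < t" using A N C by (simp add: t_def)
  have "norm (f + t *\<^sub>R (a * e)) \<le> 1 + \<eta> * t"
  proof (rule norm)
    fix I assume "I \<in> \<I>"
    then have I: "Lp_modular p I" by (rule I)
    \<comment> \<open>The list is the uniform convexity inequality brought to one side, with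
      \<open>1\<close> and \<open>f\<close> in place of \<open>z\<close> and
      \<open>w\<close>.\<close>
    have "0 \<le> (\<Sum>(\<alpha>, c, d)\<leftarrow>[(\<epsilon> + C / 2, 1, 0), (\<epsilon> + C / 2, 0, 1), (- C, 1 / 2, 1 / 2), (- 1, 1, - 1)].
        \<alpha> * I (c *\<^sub>R 1 + d *\<^sub>R f))"
    proof (rule Lp_modular_combination[OF I])
      fix z w :: complex
      have "(z + w) / 2 = of_real (1 / 2) * z + of_real (1 / 2) * w" by (simp add: add_divide_distrib)
      then show "0 \<le> (\<Sum>(\<alpha>, c, d)\<leftarrow>[(\<epsilon> + C / 2, 1, 0), (\<epsilon> + C / 2, 0, 1), (- C, 1 / 2, 1 / 2), (- 1, 1, - 1)].
        \<alpha> * cmod (of_real c * z + of_real d * w) powr p)"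
        using C(2)[of z w] by (simp add: algebra_simps add_divide_distrib)
    qed
    then have Ie: "I e \<le> (\<epsilon> + C / 2) * (I 1 + I f) - C * I ((1 / 2) *\<^sub>R 1 + (1 / 2) *\<^sub>R f)"
      by (simp add: e algebra_simps add_divide_distrib)
    have "f * ((1 / 2) *\<^sub>R 1 + (1 / 2) *\<^sub>R f) = f"
      by (simp add: distrib_left f flip: scaleR_left_distrib)
    then have If: "I f \<le> I ((1 / 2) *\<^sub>R 1 + (1 / 2) *\<^sub>R f)"
      using Lp_modular_contraction[OF p I f(2)] by metis
    have I1: "I 1 \<le> 1" "I f \<le> 1" "0 \<le> I e"
      using Lp_modular_bound[OF I, of 1] Lp_modular_contraction[OF p I f(2), of 1]
        Lp_modular_nonneg[OF I, of e] by auto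
    have "(\<epsilon> + C / 2) * (I 1 + I f) \<le> (\<epsilon> + C / 2) * (1 + I f)"
      using I1(1) C(1) \<epsilon> by (intro mult_left_mono) auto
    moreover have "C * I f \<le> C * I ((1 / 2) *\<^sub>R 1 + (1 / 2) *\<^sub>R f)"
      using If C(1) by (intro mult_left_mono) auto
    ultimately have "I e \<le> (\<epsilon> + C / 2) * (1 + I f) - C * I f" using Ie by linarith
    also have "\<dots> \<le> 2 * \<epsilon> + C / 2 * (1 - I f)"
      using mult_left_mono[OF I1(2), of \<epsilon>] \<epsilon>
      by (simp add: algebra_simps add_divide_distrib diff_divide_distrib)
    finally have Ie: "I e \<le> 2 * \<epsilon> + C / 2 * (1 - I f)" .
    have "I (a * e) \<le> A * I e"
      using Lp_modular_mult[OF I, of a e] mult_right_mono[OF A(2) I1(3)] by linarith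
    also have "\<dots> \<le> A * (2 * \<epsilon> + C / 2 * (1 - I f))" using Ie A by (intro mult_left_mono) auto
    finally have "N * t * I (a * e) \<le> N * t * (A * (2 * \<epsilon> + C / 2 * (1 - I f)))"
      using N t by (intro mult_left_mono) auto
    also have "\<dots> = \<eta> * t + (1 - I f)"
      using N A C by (simp add: t_def \<epsilon>_def field_simps)
    finally have main: "I f + N * t * I (a * e) \<le> 1 + \<eta> * t" by simp
    \<comment> \<open>The list encodes \<open>cmod_add_powr_le\<close> for \<open>f\<close> and
      \<open>a * e\<close>.\<close>
    have "0 \<le> (\<Sum>(\<alpha>, c, d)\<leftarrow>[((1 + \<eta> * t) powr (p - 1), 1, 0),
        ((1 + \<eta> * t) powr (p - 1) * (N * t), 0, 1), (- 1, 1, t)]. \<alpha> * I (c *\<^sub>R f + d *\<^sub>R (a * e)))"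
    proof (rule Lp_modular_combination[OF I])
      fix z w
      show "0 \<le> (\<Sum>(\<alpha>, c, d)\<leftarrow>[((1 + \<eta> * t) powr (p - 1), 1, 0),
        ((1 + \<eta> * t) powr (p - 1) * (N * t), 0, 1), (- 1, 1, t)].
          \<alpha> * cmod (of_real c * z + of_real d * w) powr p)"
        using cmod_add_powr_le[OF p \<eta> t, of z w] by (simp add: N_def algebra_simps)
    qed
    then have "I (f + t *\<^sub>R (a * e)) \<le> (1 + \<eta> * t) powr (p - 1) * (I f + N * t * I (a * e))"
      by (simp add: algebra_simps)
    also have "\<dots> \<le> (1 + \<eta> * t) powr (p - 1) * (1 + \<eta> * t)"
      using main by (intro mult_left_mono) auto
    also have "\<dots> = (1 + \<eta> * t) powr p"
      using \<eta> t by (simp add: powr_mult_base mult.commute add_pos_pos)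
    finally show "I (f + t *\<^sub>R (a * e)) \<le> (1 + \<eta> * t) powr p" .
  qed (use \<eta> t in simp)
  then show ?thesis using t by blast
qed

text \<open>Because \<open>f * e = 0\<close>, \<open>f\<close> maps
  \<open>f - t *\<^sub>R (e * a)\<close> to \<open>f\<close>, so this perturbation is at least as
  large as \<open>f\<close>. Smoothness bounds the sum of both perturbations, which leaves little
  growth for the other one.\<close>

lemma exists_norm_add_right_le:
  fixes f e a :: "'a :: real_normed_algebra_1" and \<I> :: "('a \<Rightarrow> real) set"
  assumes p: "1 < p" and I: "\<And>I. I \<in> \<I> \<Longrightarrow> Lp_modular p I"
    and norm: "\<And>b c. 0 \<le> c \<Longrightarrow> (\<And>I. I \<in> \<I> \<Longrightarrow> I b \<le> c powr p) \<Longrightarrow> norm b \<le> c"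
    and f: "f * f = f" "norm f \<le> 1" and e: "e = 1 - f" and \<eta>: "0 < \<eta>"
  shows "\<exists>t>0. norm (f + t *\<^sub>R (e * a)) \<le> 1 + \<eta> * t"
proof -
  \<comment> \<open>A bound for \<open>I f + I (e * a)\<close> valid for every \<open>I\<close>;
    smoothness with \<open>\<eta> / V\<close> then costs at most \<open>\<eta> * t\<close>.\<close>
  define V where "V = 1 + norm (e * a) powr p"
  have V: "0 < V" by (simp add: V_def add_pos_nonneg)
  then have "0 < \<eta> / V" using \<eta> by simp
  then obtain t where t: "0 < t" "\<And>z w :: complex. cmod (z + of_real t * w) powr p
      + cmod (z - of_real t * w) powr p - 2 * cmod z powr p \<le> \<eta> / V * t * (cmod z powr p + cmod w powr p)"
    using cmod_powr_uniformly_smooth[OF p] by metis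
  define \<kappa> where "\<kappa> = \<eta> / V * t"
  have \<kappa>: "0 < \<kappa>" "\<kappa> * V = \<eta> * t" using \<eta> t V by (auto simp: \<kappa>_def)
  have "norm (f + t *\<^sub>R (e * a)) \<le> 1 + \<eta> * t"
  proof (rule norm)
    fix I assume "I \<in> \<I>"
    then have I: "Lp_modular p I" by (rule I)
    have "0 \<le> (\<Sum>(\<alpha>, c, d)\<leftarrow>[(2 + \<kappa>, 1, 0), (\<kappa>, 0, 1), (- 1, 1, t), (- 1, 1, - t)].
        \<alpha> * I (c *\<^sub>R f + d *\<^sub>R (e * a)))"
    proof (rule Lp_modular_combination[OF I])
      fix z w
      show "0 \<le> (\<Sum>(\<alpha>, c, d)\<leftarrow>[(2 + \<kappa>, 1, 0), (\<kappa>, 0, 1), (- 1, 1, t), (- 1, 1, - t)].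
          \<alpha> * cmod (of_real c * z + of_real d * w) powr p)"
        using t(2)[of z w] unfolding \<kappa>_def[symmetric] by (simp add: algebra_simps)
    qed
    then have "I (f + t *\<^sub>R (e * a)) + I (f - t *\<^sub>R (e * a)) \<le> 2 * I f + \<kappa> * (I f + I (e * a))"
      by (simp add: algebra_simps)
    moreover have "I f \<le> I (f - t *\<^sub>R (e * a))"
    proof -
      have "f * (f - t *\<^sub>R (e * a)) = f"
        by (simp add: e f algebra_simps flip: mult.assoc)
      then show ?thesis using Lp_modular_contraction[OF p I f(2)] by metis
    qed
    moreover have If: "I f \<le> 1"
      using Lp_modular_bound[OF I, of 1] Lp_modular_contraction[OF p I f(2), of 1] by simp
    moreover have "\<kappa> * (I f + I (e * a)) \<le> \<kappa> * V"
      using If Lp_modular_bound[OF I, of "e * a"] \<kappa> by (intro mult_left_mono) (auto simp: V_def)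
    ultimately have "I (f + t *\<^sub>R (e * a)) \<le> 1 + \<eta> * t" using \<kappa> by simp
    also have "\<dots> \<le> (1 + \<eta> * t) powr p"
      using powr_mono[of 1 p "1 + \<eta> * t"] p \<eta> t by simp
    finally show "I (f + t *\<^sub>R (e * a)) \<le> (1 + \<eta> * t) powr p" .
  qed (use \<eta> t in simp)
  then show ?thesis using t by blast
qed

section \<open>From bounds on real parts to vanishing of the state\<close>

lemma state_eq_zero:
  fixes \<phi> :: "'a :: complex_banach_algebra_1 \<Rightarrow> complex"
  assumes \<phi>: "state \<phi>" and Re: "\<And>c. Re (\<phi> (c *\<^sub>C b)) \<le> 0"
  shows "\<phi> b = 0"
proof -
  \<comment> \<open>The choice of the conjugate as scalar makes the real part the squared
    modulus.\<close>
  have "Re (cnj (\<phi> b) * \<phi> b) \<le> 0" using Re[of "cnj (\<phi> b)"] \<phi> by (simp add: state_def)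
  then have "(Re (\<phi> b))\<^sup>2 + (Im (\<phi> b))\<^sup>2 \<le> 0" by (simp add: power2_eq_square)
  then show ?thesis by (simp add: sum_power2_le_zero_iff complex_eq_iff)
qed

theorem lemma4p19:
  fixes p :: real
    and \<phi> :: "'a :: complex_banach_algebra_1 \<Rightarrow> complex"
    and e :: 'a
  assumes "1 < p"
    and "Lp_operator_algebra p TYPE('x) TYPE('a)"
    and "state \<phi>"
    and "idempotent e"
    and "real_positive e"
    and "\<phi> e = 0"
  shows "\<forall>a. \<phi> (a * e) = 0 \<and> \<phi> (e * a) = 0"
proof
  fix a
  obtain \<I> :: "('a \<Rightarrow> real) set" where I: "\<And>I. I \<in> \<I> \<Longrightarrow> Lp_modular p I"
    "\<And>b c. 0 \<le> c \<Longrightarrow> (\<And>I. I \<in> \<I> \<Longrightarrow> I b \<le> c powr p) \<Longrightarrow> norm b \<le> c"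
    using Lp_operator_algebra_modulars[OF assms(1,2)] by blast
  interpret bounded_linear \<phi> using assms(3) by (simp add: state_def)
  define f where "f = 1 - e"
  have f: "f * f = f" "norm f \<le> 1" "e = 1 - f"
    using assms(4) norm_one_minus_idempotent_le[OF assms(4,5)]
    by (simp_all add: f_def idempotent_def algebra_simps)
  have \<phi>f: "\<phi> f = 1" using assms(3,6) by (simp add: f_def diff state_def)
  \<comment> \<open>The scalar is absorbed into \<open>a\<close>, for which the perturbation
    estimate is arbitrary.\<close>
  have "Re (\<phi> (c *\<^sub>C (a * e))) \<le> 0" for c
    using state_Re_le_zero[OF assms(3) \<phi>f exists_norm_add_left_le[OF assms(1) I f]]
    by (simp flip: mult_scaleC_left)
  moreover have "Re (\<phi> (c *\<^sub>C (e * a))) \<le> 0" for c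
    using state_Re_le_zero[OF assms(3) \<phi>f exists_norm_add_right_le[OF assms(1) I f]]
    by (simp flip: mult_scaleC_right)
  ultimately show "\<phi> (a * e) = 0 \<and> \<phi> (e * a) = 0"
    using state_eq_zero[OF assms(3)] by blast
qed

end
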